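(* Let $K$ be an algebraically closed field, let $1\leq t\leq n-1$ be integers, let $X=(x_{ij})$ be an $n\times n$ matrix of indeterminates, $S=K[X]$, $\Delta=\det X$, and $S_\Delta=S[\frac1\Delta]$. Then the $K$-algebra automorphism of $S_\Delta$ given by $X\mapsto X^{-1}$ (sending each entry $x_{ij}$ of $X$ to the $(i,j)$ entry of $X^{-1}$) induces an isomorphism of schemes $\mathscr Y_{n,n,t}\cong\mathscr Y_{n,n,n-t}$.
   Context: $K[X]$ is the polynomial ring over $K$ in the entries of $X$. A minor is principal if it is defined by the same row and column indices. For $1\leq s\leq n$, $\mathfrak P_s\subseteq K[X]$ is the ideal generated by the $s\times s$ principal minors of $X$. $\mathscr Y_{n,n,s}$ is the locally closed set of matrices of rank exactly $n$ (i.e. invertible matrices) in the vanishing locus $\mathscr V(\mathfrak P_s)\subseteq\operatorname{Spec}K[X]$; as a scheme it is the closed subscheme of $\operatorname{Spec}(S_\Delta)\cong \mathrm{GL}(n,K)$ defined by the ideal $\mathfrak P_sS_\Delta$, that is, $\mathscr Y_{n,n,s}=\operatorname{Spec}(S_\Delta/\mathfrak P_sS_\Delta)$. *)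

theory Defs
  imports
    "HOL-Analysis.Determinants"
    "HOL-Analysis.Abstract_Topology"
    "HOL-Library.Poly_Mapping"
    "HOL-Algebra.QuotRing"
    "HOL-Algebra.Algebraic_Closure_Type"
begin

section \<open>Localization of a commutative ring\<close>

text \<open>
  For a multiplicative subset \<open>M\<close>, \<open>fraction R M a s\<close> is the fraction \<open>a/s\<close>, that is, the class of
  \<open>(a, s)\<close> under the relation \<open>u (a t - b s) = 0\<close> for some \<open>u \<in> M\<close>.
\<close>

definition fraction :: "('a, 'm) ring_scheme \<Rightarrow> 'a set \<Rightarrow> 'a \<Rightarrow> 'a \<Rightarrow> ('a \<times> 'a) set" where
  "fraction R M a s = {(b, t). b \<in> carrier R \<and> t \<in> M \<and>
     (\<exists>u\<in>M. u \<otimes>\<^bsub>R\<^esub> (a \<otimes>\<^bsub>R\<^esub> t) = u \<otimes>\<^bsub>R\<^esub> (b \<otimes>\<^bsub>R\<^esub> s))}"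

text \<open>
  Each operation takes the union over all representatives of the two classes; all the sets in this
  union are the same class.
\<close>

definition localization :: "('a, 'm) ring_scheme \<Rightarrow> 'a set \<Rightarrow> ('a \<times> 'a) set ring" where
  "localization R M = \<lparr>
     carrier = {fraction R M a s | a s. a \<in> carrier R \<and> s \<in> M},
     monoid.mult = (\<lambda>A B. \<Union>(a, s)\<in>A. \<Union>(b, t)\<in>B. fraction R M (a \<otimes>\<^bsub>R\<^esub> b) (s \<otimes>\<^bsub>R\<^esub> t)),
     one = fraction R M \<one>\<^bsub>R\<^esub> \<one>\<^bsub>R\<^esub>,
     ring.zero = fraction R M \<zero>\<^bsub>R\<^esub> \<one>\<^bsub>R\<^esub>,
     add = (\<lambda>A B. \<Union>(a, s)\<in>A. \<Union>(b, t)\<in>B.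
              fraction R M (a \<otimes>\<^bsub>R\<^esub> t \<oplus>\<^bsub>R\<^esub> b \<otimes>\<^bsub>R\<^esub> s) (s \<otimes>\<^bsub>R\<^esub> t))\<rparr>"

definition powers :: "('a, 'm) ring_scheme \<Rightarrow> 'a \<Rightarrow> 'a set" where
  "powers R f = {f [^]\<^bsub>R\<^esub> (k::nat) | k. True}"

definition stalk_at :: "('a, 'm) ring_scheme \<Rightarrow> 'a set \<Rightarrow> ('a \<times> 'a) set ring" where
  "stalk_at R p = localization R (carrier R - p)"

definition fraction_at :: "('a, 'm) ring_scheme \<Rightarrow> 'a set \<Rightarrow> 'a \<Rightarrow> 'a \<Rightarrow> ('a \<times> 'a) set" where
  "fraction_at R p = fraction R (carrier R - p)"


section \<open>Ringed spaces and morphisms of locally ringed spaces\<close>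

record ('p, 's) ringed_space =
  sp :: "'p topology"
  sec :: "'p set \<Rightarrow> 's ring"
  res :: "'p set \<Rightarrow> 'p set \<Rightarrow> 's \<Rightarrow> 's"

text \<open>
  A morphism \<open>Xs \<rightarrow> Ys\<close> is a pair \<open>(f, h)\<close> of a map on points and a family of maps
  \<open>h V : O(V) \<rightarrow> O(f\<^sup>-\<^sup>1 V)\<close>.
\<close>

type_synonym ('p, 's, 'q, 't) rs_map = "('p \<Rightarrow> 'q) \<times> ('q set \<Rightarrow> 't \<Rightarrow> 's)"

definition preimg :: "('p, 's) ringed_space \<Rightarrow> ('p \<Rightarrow> 'q) \<Rightarrow> 'q set \<Rightarrow> 'p set" where
  "preimg Xs f V = {x \<in> topspace (sp Xs). f x \<in> V}"

text \<open>The germ at \<open>x\<close> of a section \<open>s\<close> over \<open>U\<close> is a unit of the stalk at \<open>x\<close>.\<close>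

definition germ_unit :: "('p, 's) ringed_space \<Rightarrow> 'p \<Rightarrow> 'p set \<Rightarrow> 's \<Rightarrow> bool" where
  "germ_unit Xs x U s \<longleftrightarrow>
     (\<exists>W. openin (sp Xs) W \<and> x \<in> W \<and> W \<subseteq> U \<and> res Xs U W s \<in> Units (sec Xs W))"

text \<open>
  The last clause says that the homomorphisms induced on stalks are local, i.e. send nonunits
  to nonunits.
\<close>

definition lrs_morphism ::
  "('p, 's) ringed_space \<Rightarrow> ('q, 't) ringed_space \<Rightarrow> ('p, 's, 'q, 't) rs_map \<Rightarrow> bool" where
  "lrs_morphism Xs Ys = (\<lambda>(f, h).
     continuous_map (sp Xs) (sp Ys) f \<and>
     (\<forall>V. openin (sp Ys) V \<longrightarrow> h V \<in> ring_hom (sec Ys V) (sec Xs (preimg Xs f V))) \<and>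
     (\<forall>V W s. openin (sp Ys) V \<and> openin (sp Ys) W \<and> W \<subseteq> V \<and> s \<in> carrier (sec Ys V) \<longrightarrow>
        h W (res Ys V W s) = res Xs (preimg Xs f V) (preimg Xs f W) (h V s)) \<and>
     (\<forall>x V s. x \<in> topspace (sp Xs) \<and> openin (sp Ys) V \<and> f x \<in> V \<and> s \<in> carrier (sec Ys V) \<and>
        germ_unit Xs x (preimg Xs f V) (h V s) \<longrightarrow> germ_unit Ys (f x) V s))"

definition rs_id :: "('p, 's, 'p, 's) rs_map" where
  "rs_id = (id, \<lambda>_. id)"

text \<open>\<open>rs_comp Ys G F\<close> is the composite \<open>G \<circ> F\<close> of \<open>F : Xs \<rightarrow> Ys\<close> and \<open>G : Ys \<rightarrow> Zs\<close>.\<close>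

definition rs_comp ::
  "('q, 't) ringed_space \<Rightarrow> ('q, 't, 'r, 'u) rs_map \<Rightarrow> ('p, 's, 'q, 't) rs_map
    \<Rightarrow> ('p, 's, 'r, 'u) rs_map" where
  "rs_comp Ys G F = (fst G \<circ> fst F, \<lambda>W. snd F (preimg Ys (fst G) W) \<circ> snd G W)"

text \<open>
  Equality of morphisms \<open>Xs \<rightarrow> Ys\<close>; the values of the underlying HOL functions outside the points
  of \<open>Xs\<close> and the sections over open sets of \<open>Ys\<close> are irrelevant.
\<close>

definition rs_eq ::
  "('p, 's) ringed_space \<Rightarrow> ('q, 't) ringed_space \<Rightarrow> ('p, 's, 'q, 't) rs_map
    \<Rightarrow> ('p, 's, 'q, 't) rs_map \<Rightarrow> bool" where
  "rs_eq Xs Ys F G \<longleftrightarrow>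
     (\<forall>x\<in>topspace (sp Xs). fst F x = fst G x) \<and>
     (\<forall>V. openin (sp Ys) V \<longrightarrow> (\<forall>s\<in>carrier (sec Ys V). snd F V s = snd G V s))"

definition lrs_isomorphism ::
  "('p, 's) ringed_space \<Rightarrow> ('q, 't) ringed_space \<Rightarrow> ('p, 's, 'q, 't) rs_map \<Rightarrow> bool" where
  "lrs_isomorphism Xs Ys F \<longleftrightarrow> lrs_morphism Xs Ys F \<and>
     (\<exists>G. lrs_morphism Ys Xs G \<and>
          rs_eq Xs Xs (rs_comp Ys G F) rs_id \<and> rs_eq Ys Ys (rs_comp Xs F G) rs_id)"


section \<open>The spectrum of a commutative ring\<close>

definition primes :: "('a, 'm) ring_scheme \<Rightarrow> 'a set set" where
  "primes R = {p. primeideal p R}"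

definition zariski_open :: "('a, 'm) ring_scheme \<Rightarrow> 'a set set \<Rightarrow> bool" where
  "zariski_open R U \<longleftrightarrow> (\<exists>E\<subseteq>carrier R. U = {p \<in> primes R. \<not> E \<subseteq> p})"

lemma istopology_zariski_open: "istopology (zariski_open R)"
  unfolding istopology_def
proof (intro conjI allI impI)
  fix U V assume "zariski_open R U" "zariski_open R V"
  then obtain E F where E: "E \<subseteq> carrier R" "U = {p \<in> primes R. \<not> E \<subseteq> p}"
    and F: "F \<subseteq> carrier R" "V = {p \<in> primes R. \<not> F \<subseteq> p}"
    unfolding zariski_open_def by blast
  let ?G = "{x \<otimes>\<^bsub>R\<^esub> y | x y. x \<in> E \<and> y \<in> F}"
  have iff: "?G \<subseteq> p \<longleftrightarrow> E \<subseteq> p \<or> F \<subseteq> p" if "p \<in> primes R" for p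
  proof -
    interpret primeideal p R using that by (simp add: primes_def)
    show ?thesis
    proof
      assume G: "?G \<subseteq> p"
      show "E \<subseteq> p \<or> F \<subseteq> p"
      proof (rule ccontr)
        assume "\<not> (E \<subseteq> p \<or> F \<subseteq> p)"
        then obtain x y where xy: "x \<in> E" "x \<notin> p" "y \<in> F" "y \<notin> p" by blast
        then have "x \<otimes>\<^bsub>R\<^esub> y \<in> p" using G by blast
        then show False using I_prime xy E F by blast
      qed
    next
      assume "E \<subseteq> p \<or> F \<subseteq> p"
      then show "?G \<subseteq> p"
        using E(1) F(1) I_l_closed I_r_closed by blast
    qed
  qed
  show "zariski_open R (U \<inter> V)"
  proof (cases "primes R = {}")
    case True
    then show ?thesis unfolding zariski_open_def E F by auto
  next
    case False
    then obtain q where "primeideal q R" by (auto simp: primes_def)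
    then interpret primeideal q R .
    have "?G \<subseteq> carrier R" using E(1) F(1) by blast
    moreover have "U \<inter> V = {p \<in> primes R. \<not> ?G \<subseteq> p}"
      unfolding E F using iff by blast
    ultimately show ?thesis unfolding zariski_open_def by blast
  qed
next
  fix \<K> assume "\<forall>K\<in>\<K>. zariski_open R K"
  then have "\<forall>K. \<exists>E. K \<in> \<K> \<longrightarrow> E \<subseteq> carrier R \<and> K = {p \<in> primes R. \<not> E \<subseteq> p}"
    unfolding zariski_open_def by blast
  then obtain E where E: "\<And>K. K \<in> \<K> \<Longrightarrow> E K \<subseteq> carrier R \<and> K = {p \<in> primes R. \<not> E K \<subseteq> p}"
    by metis
  have "\<Union>\<K> = {p \<in> primes R. \<not> (\<Union>K\<in>\<K>. E K) \<subseteq> p}"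
    using E by blast
  moreover have "(\<Union>K\<in>\<K>. E K) \<subseteq> carrier R" using E by blast
  ultimately show "zariski_open R (\<Union>\<K>)" unfolding zariski_open_def by blast
qed

definition zariski :: "('a, 'm) ring_scheme \<Rightarrow> 'a set topology" where
  "zariski R = topology (zariski_open R)"

text \<open>
  Sections over \<open>U\<close> are the functions on \<open>U\<close> with values in the local rings \<open>R\<^sub>p\<close> that are locally
  quotients of elements of \<open>R\<close>.
\<close>

definition sections ::
  "('a, 'm) ring_scheme \<Rightarrow> 'a set set \<Rightarrow> ('a set \<Rightarrow> ('a \<times> 'a) set) set" where
  "sections R U = {s \<in> (\<Pi>\<^sub>E p\<in>U. carrier (stalk_at R p)).
     \<forall>p\<in>U. \<exists>V. openin (zariski R) V \<and> p \<in> V \<and> V \<subseteq> U \<and>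
       (\<exists>a\<in>carrier R. \<exists>g\<in>carrier R. \<forall>q\<in>V. g \<notin> q \<and> s q = fraction_at R q a g)}"

definition structure_ring ::
  "('a, 'm) ring_scheme \<Rightarrow> 'a set set \<Rightarrow> ('a set \<Rightarrow> ('a \<times> 'a) set) ring" where
  "structure_ring R U = \<lparr>
     carrier = sections R U,
     monoid.mult = (\<lambda>s t. \<lambda>p\<in>U. s p \<otimes>\<^bsub>stalk_at R p\<^esub> t p),
     one = (\<lambda>p\<in>U. \<one>\<^bsub>stalk_at R p\<^esub>),
     ring.zero = (\<lambda>p\<in>U. \<zero>\<^bsub>stalk_at R p\<^esub>),
     add = (\<lambda>s t. \<lambda>p\<in>U. s p \<oplus>\<^bsub>stalk_at R p\<^esub> t p)\<rparr>"

definition Spec ::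
  "('a, 'm) ring_scheme \<Rightarrow> ('a set, 'a set \<Rightarrow> ('a \<times> 'a) set) ringed_space" where
  "Spec R = \<lparr>sp = zariski R, sec = structure_ring R, res = (\<lambda>U V s. restrict s V)\<rparr>"

text \<open>
  \<open>Spec_map A B \<phi> : Spec B \<rightarrow> Spec A\<close> is the morphism of a ring homomorphism \<open>\<phi> : A \<rightarrow> B\<close>. On points
  it is \<open>q \<mapsto> \<phi>\<^sup>-\<^sup>1 q\<close>; a section \<open>s\<close> is sent to \<open>q \<mapsto> \<phi>\<^sub>q (s (\<phi>\<^sup>-\<^sup>1 q))\<close> where \<open>\<phi>\<^sub>q\<close> is the map
  \<open>a/g \<mapsto> \<phi> a/\<phi> g\<close> of local rings.
\<close>

definition contract :: "('a, 'm) ring_scheme \<Rightarrow> ('a \<Rightarrow> 'b) \<Rightarrow> 'b set \<Rightarrow> 'a set" where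
  "contract A \<phi> q = {a \<in> carrier A. \<phi> a \<in> q}"

definition stalk_map ::
  "('b, 'm) ring_scheme \<Rightarrow> ('a \<Rightarrow> 'b) \<Rightarrow> 'b set \<Rightarrow> ('a \<times> 'a) set \<Rightarrow> ('b \<times> 'b) set" where
  "stalk_map B \<phi> q x = (\<Union>(a, g)\<in>x. fraction_at B q (\<phi> a) (\<phi> g))"

definition Spec_map ::
  "('a, 'm) ring_scheme \<Rightarrow> ('b, 'l) ring_scheme \<Rightarrow> ('a \<Rightarrow> 'b)
    \<Rightarrow> ('b set, 'b set \<Rightarrow> ('b \<times> 'b) set, 'a set, 'a set \<Rightarrow> ('a \<times> 'a) set) rs_map" where
  "Spec_map A B \<phi> =
     (contract A \<phi>,
      \<lambda>V s. \<lambda>q\<in>preimg (Spec B) (contract A \<phi>) V. stalk_map B \<phi> q (s (contract A \<phi> q)))"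

definition closed_subscheme ::
  "('a, 'm) ring_scheme \<Rightarrow> 'a set \<Rightarrow> ('a set set, 'a set set \<Rightarrow> ('a set \<times> 'a set) set) ringed_space"
  where "closed_subscheme R I = Spec (R Quot I)"

definition closed_immersion ::
  "('a, 'm) ring_scheme \<Rightarrow> 'a set
    \<Rightarrow> ('a set set, 'a set set \<Rightarrow> ('a set \<times> 'a set) set, 'a set, 'a set \<Rightarrow> ('a \<times> 'a) set) rs_map"
  where "closed_immersion R I = Spec_map R (R Quot I) (\<lambda>a. I +>\<^bsub>R\<^esub> a)"


section \<open>The generic matrix and its principal minors\<close>

text \<open>
  Rows and columns are indexed by the finite type \<open>'n\<close>, so \<open>n = CARD('n)\<close>. Polynomials over \<open>'k\<close>
  in the variables \<open>x\<^sub>i\<^sub>j\<close> are finitely supported functions from monomials, i.e. finitely supported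
  exponent functions on \<open>'n \<times> 'n\<close>, to \<open>'k\<close>.
\<close>

type_synonym ('k, 'n) mpoly = "(('n \<times> 'n) \<Rightarrow>\<^sub>0 nat) \<Rightarrow>\<^sub>0 'k"

definition const :: "'k::comm_ring_1 \<Rightarrow> ('k, 'n) mpoly" where
  "const c = Poly_Mapping.single 0 c"

definition gen_mat :: "('k::comm_ring_1, 'n::finite) mpoly ^ 'n ^ 'n" where
  "gen_mat = (\<chi> i j. Poly_Mapping.single (Poly_Mapping.single (i, j) 1) 1)"

definition principal_minor :: "'a::comm_ring_1 ^ 'n ^ 'n \<Rightarrow> 'n::finite set \<Rightarrow> 'a" where
  "principal_minor A I = (\<Sum>p | p permutes I. of_int (sign p) * (\<Prod>i\<in>I. A $ i $ p i))"

lemma principal_minor_UNIV: "principal_minor A UNIV = det A"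
  by (simp add: principal_minor_def det_def)

abbreviation S_ring :: "('k::comm_ring_1, 'n::finite) mpoly ring" where
  "S_ring \<equiv> ring_of_type_algebra"

definition P_ideal :: "nat \<Rightarrow> ('k::comm_ring_1, 'n::finite) mpoly set" where
  "P_ideal s = Idl\<^bsub>S_ring\<^esub> {principal_minor gen_mat I | I. card I = s}"

type_synonym ('k, 'n) S\<Delta> = "(('k, 'n) mpoly \<times> ('k, 'n) mpoly) set"

definition S\<Delta>_ring :: "('k::comm_ring_1, 'n::finite) S\<Delta> ring" where
  "S\<Delta>_ring = localization S_ring (powers S_ring (det gen_mat))"

definition to_S\<Delta> :: "('k::comm_ring_1, 'n::finite) mpoly \<Rightarrow> ('k, 'n) S\<Delta>" where
  "to_S\<Delta> a = fraction S_ring (powers S_ring (det gen_mat)) a 1"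

definition P_ideal_S\<Delta> :: "nat \<Rightarrow> ('k::comm_ring_1, 'n::finite) S\<Delta> set" where
  "P_ideal_S\<Delta> s = Idl\<^bsub>S\<Delta>_ring\<^esub> (to_S\<Delta> ` P_ideal s)"

abbreviation Y_scheme where "Y_scheme s \<equiv> closed_subscheme S\<Delta>_ring (P_ideal_S\<Delta> s)"

abbreviation Y_immersion where "Y_immersion s \<equiv> closed_immersion S\<Delta>_ring (P_ideal_S\<Delta> s)"


section \<open>The inversion automorphism\<close>

definition matrix_inverse_in ::
  "('a, 'm) ring_scheme \<Rightarrow> ('n::finite \<Rightarrow> 'n \<Rightarrow> 'a) \<Rightarrow> ('n \<Rightarrow> 'n \<Rightarrow> 'a) \<Rightarrow> bool" where
  "matrix_inverse_in R A B \<longleftrightarrow> (\<forall>i j.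
     A i j \<in> carrier R \<and> B i j \<in> carrier R \<and>
     (\<Oplus>\<^bsub>R\<^esub>k\<in>UNIV. A i k \<otimes>\<^bsub>R\<^esub> B k j) = (if i = j then \<one>\<^bsub>R\<^esub> else \<zero>\<^bsub>R\<^esub>) \<and>
     (\<Oplus>\<^bsub>R\<^esub>k\<in>UNIV. B i k \<otimes>\<^bsub>R\<^esub> A k j) = (if i = j then \<one>\<^bsub>R\<^esub> else \<zero>\<^bsub>R\<^esub>))"

definition K_algebra_automorphism ::
  "(('k::comm_ring_1, 'n::finite) S\<Delta> \<Rightarrow> ('k, 'n) S\<Delta>) \<Rightarrow> bool" where
  "K_algebra_automorphism \<phi> \<longleftrightarrow>
     \<phi> \<in> ring_iso S\<Delta>_ring S\<Delta>_ring \<and> (\<forall>c. \<phi> (to_S\<Delta> (const c)) = to_S\<Delta> (const c))"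

definition inversion_automorphism ::
  "(('k::comm_ring_1, 'n::finite) S\<Delta> \<Rightarrow> ('k, 'n) S\<Delta>) \<Rightarrow> bool" where
  "inversion_automorphism \<phi> \<longleftrightarrow> K_algebra_automorphism \<phi> \<and>
     matrix_inverse_in S\<Delta>_ring
       (\<lambda>i j. to_S\<Delta> (gen_mat $ i $ j)) (\<lambda>i j. \<phi> (to_S\<Delta> (gen_mat $ i $ j)))"

end

theory Submission
  imports Defs
begin

text \<open>
  Let \<open>A\<close> be an invertible matrix over a commutative ring, let \<open>B = A\<^sup>-\<^sup>1\<close>, and let \<open>I\<close> be a set of
  indices. Replace the rows of \<open>A\<close> outside \<open>I\<close> by those of the identity matrix; the determinant of the
  result \<open>A\<^sub>I\<close> is the principal minor of \<open>A\<close> on \<open>I\<close>. The rows of \<open>A\<^sub>I B\<close> are those of the identity for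
  indices in \<open>I\<close> and those of \<open>B\<close> for the others, so its determinant is the principal minor of \<open>B\<close> on the
  complement of \<open>I\<close>. Hence the principal minors of \<open>A\<^sup>-\<^sup>1\<close> are, up to the unit \<open>det A\<^sup>-\<^sup>1\<close>, the
  complementary principal minors of \<open>A\<close> (\<open>principal_minor_inverse\<close>). Applied to the generic matrix
  over \<open>S\<^sub>\<Delta>\<close>, this says that \<open>X \<mapsto> X\<^sup>-\<^sup>1\<close> sends each generator of \<open>P\<^sub>s S\<^sub>\<Delta>\<close> to a multiple of a generator of
  \<open>P\<^bsub>n-s\<^esub> S\<^sub>\<Delta>\<close>; as the inverse of an inversion automorphism is again one, the two ideals are
  exchanged (\<open>inversion_automorphism_P_ideal\<close>).

  An isomorphism of rings that carries one ideal onto another induces an isomorphism of the quotient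
  rings, and the functor \<open>Spec\<close> turns it into an isomorphism of the closed subschemes that is
  compatible with the closed immersions (\<open>closed_subscheme_iso\<close>). Two facts are behind this: the map
  of spectra attached to a ring homomorphism is a morphism of locally ringed spaces
  (\<open>lrs_morphism_Spec_map\<close>), and it depends functorially on the homomorphism (\<open>Spec_map_comp\<close>,
  \<open>Spec_map_id\<close>). Both are checked in the local rings, where elements are fractions.

  The automorphism exists because a homomorphism of algebras from \<open>S\<^sub>\<Delta>\<close> is the same as an evaluation of
  the variables at an invertible matrix: polynomials can be evaluated at \<open>X\<^sup>-\<^sup>1\<close>, the determinant \<open>\<Delta>\<close> goes to
  a unit, and the universal property of localization applies. Its square fixes constants and
  entries of \<open>X\<close>, so it is the identity (\<open>exists_inversion_automorphism\<close>). Since determinants are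
  defined for matrices over a commutative ring type, \<open>S\<^sub>\<Delta>\<close> is made into such a type, \<open>gl_ring\<close>.
\<close>

text \<open>The symbol \<open>$\<close> stands for matrix entries here, not for coefficients of power series.\<close>

unbundle no fps_syntax


section \<open>Localizations\<close>

locale multiplicative_subset = cring R for R (structure) +
  fixes M
  assumes subset: "M \<subseteq> carrier R"
    and one_mem [simp, intro]: "\<one> \<in> M"
    and mult_mem [simp, intro]: "\<lbrakk>s \<in> M; t \<in> M\<rbrakk> \<Longrightarrow> s \<otimes> t \<in> M"
begin

lemma carr: "s \<in> M \<Longrightarrow> s \<in> carrier R"
  using subset by blast

(* carr loops as a simp rule for M = carrier R - p, so it is one inside this block only *)
context
  notes carr [simp, intro]
begin

lemma mem_fraction_iff:
  "(b, t) \<in> fraction R M a s \<longleftrightarrow>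
     b \<in> carrier R \<and> t \<in> M \<and> (\<exists>u\<in>M. u \<otimes> (a \<otimes> t) = u \<otimes> (b \<otimes> s))"
  by (simp add: fraction_def)

lemma mem_fraction_refl: "a \<in> carrier R \<Longrightarrow> s \<in> M \<Longrightarrow> (a, s) \<in> fraction R M a s"
  using mem_fraction_iff one_mem by blast

lemma cross_equal_trans:
  assumes "a \<in> carrier R" "b \<in> carrier R" "c \<in> carrier R" "s \<in> M" "t \<in> M" "r \<in> M"
    and "\<exists>u\<in>M. u \<otimes> (a \<otimes> t) = u \<otimes> (b \<otimes> s)" and "\<exists>v\<in>M. v \<otimes> (b \<otimes> r) = v \<otimes> (c \<otimes> t)"
  shows "\<exists>w\<in>M. w \<otimes> (a \<otimes> r) = w \<otimes> (c \<otimes> s)"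
proof -
  obtain u v where uv: "u \<in> M" "v \<in> M"
    and u: "u \<otimes> (a \<otimes> t) = u \<otimes> (b \<otimes> s)" and v: "v \<otimes> (b \<otimes> r) = v \<otimes> (c \<otimes> t)"
    using assms(7,8) by blast
  have C: "a \<in> carrier R" "b \<in> carrier R" "c \<in> carrier R" "s \<in> carrier R" "t \<in> carrier R"
    "r \<in> carrier R" "u \<in> carrier R" "v \<in> carrier R"
    using assms uv by auto
  (* the factor t makes u (a t) appear in the left-hand side and v (c t) in the right-hand side *)
  have "(u \<otimes> v \<otimes> t) \<otimes> (a \<otimes> r) = (u \<otimes> (a \<otimes> t)) \<otimes> (v \<otimes> r)"
    using C by (simp add: m_ac)
  also have "\<dots> = (v \<otimes> (b \<otimes> r)) \<otimes> (u \<otimes> s)"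
    unfolding u using C by (simp add: m_ac)
  also have "\<dots> = (u \<otimes> v \<otimes> t) \<otimes> (c \<otimes> s)"
    unfolding v using C by (simp add: m_ac)
  finally show ?thesis using uv assms(5) by blast
qed

lemma fraction_eq_iff:
  assumes "a \<in> carrier R" "b \<in> carrier R" "s \<in> M" "t \<in> M"
  shows "fraction R M a s = fraction R M b t \<longleftrightarrow> (\<exists>u\<in>M. u \<otimes> (a \<otimes> t) = u \<otimes> (b \<otimes> s))"
    (is "_ \<longleftrightarrow> ?rhs")
proof
  assume "fraction R M a s = fraction R M b t"
  then have "(b, t) \<in> fraction R M a s" using mem_fraction_refl assms by simp
  then show ?rhs by (simp add: mem_fraction_iff)
next
  assume eq: ?rhs
  then have eq': "\<exists>u\<in>M. u \<otimes> (b \<otimes> s) = u \<otimes> (a \<otimes> t)" by metis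
  show "fraction R M a s = fraction R M b t"
  proof (rule Set.set_eqI)
    fix x :: "'a \<times> 'a"
    obtain c r where x: "x = (c, r)" by fastforce
    have "(c, r) \<in> fraction R M a s" if "(c, r) \<in> fraction R M b t"
      using that cross_equal_trans[OF assms(1,2) _ assms(3,4) _ eq] by (auto simp: mem_fraction_iff)
    moreover have "(c, r) \<in> fraction R M b t" if "(c, r) \<in> fraction R M a s"
      using that cross_equal_trans[OF assms(2,1) _ assms(4,3) _ eq'] by (auto simp: mem_fraction_iff)
    ultimately show "x \<in> fraction R M a s \<longleftrightarrow> x \<in> fraction R M b t" unfolding x by blast
  qed
qed

lemma fraction_eqI:
  assumes "a \<in> carrier R" "b \<in> carrier R" "s \<in> M" "t \<in> M" "a \<otimes> t = b \<otimes> s"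
  shows "fraction R M a s = fraction R M b t"
  using assms fraction_eq_iff one_mem by metis

text \<open>
  An operation on classes that is defined as a union over all representatives can be computed on
  any one of them, as soon as it does not depend on the choice.
\<close>

lemma UN_fraction:
  assumes "a \<in> carrier R" "s \<in> M"
    and "\<And>a' s'. (a', s') \<in> fraction R M a s \<Longrightarrow> f a' s' = x"
  shows "(\<Union>(a', s')\<in>fraction R M a s. f a' s') = x"
proof (rule SUP_eq_const)
  show "fraction R M a s \<noteq> {}" using mem_fraction_refl[OF assms(1,2)] by blast
qed (use assms(3) in auto)

lemma UN_fraction2:
  assumes "a \<in> carrier R" "s \<in> M" "b \<in> carrier R" "t \<in> M"
    and "\<And>a' s' b' t'. (a', s') \<in> fraction R M a s \<Longrightarrow> (b', t') \<in> fraction R M b t \<Longrightarrow>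
      f a' s' b' t' = x"
  shows "(\<Union>(a', s')\<in>fraction R M a s. \<Union>(b', t')\<in>fraction R M b t. f a' s' b' t') = x"
  by (intro UN_fraction assms)

lemma mult_fraction:
  assumes "a \<in> carrier R" "s \<in> M" "b \<in> carrier R" "t \<in> M"
  shows "fraction R M a s \<otimes>\<^bsub>localization R M\<^esub> fraction R M b t = fraction R M (a \<otimes> b) (s \<otimes> t)"
  unfolding localization_def monoid.simps
proof (rule UN_fraction2[OF assms])
  fix a' s' b' t' assume "(a', s') \<in> fraction R M a s" "(b', t') \<in> fraction R M b t"
  then obtain u v where C: "a' \<in> carrier R" "b' \<in> carrier R" "s' \<in> M" "t' \<in> M" "u \<in> M" "v \<in> M"
    and u: "u \<otimes> (a \<otimes> s') = u \<otimes> (a' \<otimes> s)" and v: "v \<otimes> (b \<otimes> t') = v \<otimes> (b' \<otimes> t)"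
    unfolding mem_fraction_iff by blast
  have "(u \<otimes> v) \<otimes> ((a' \<otimes> b') \<otimes> (s \<otimes> t)) = (u \<otimes> (a' \<otimes> s)) \<otimes> (v \<otimes> (b' \<otimes> t))"
    using C assms by (simp add: m_ac)
  also have "\<dots> = (u \<otimes> v) \<otimes> ((a \<otimes> b) \<otimes> (s' \<otimes> t'))"
    unfolding u[symmetric] v[symmetric] using C assms by (simp add: m_ac)
  finally show "fraction R M (a' \<otimes> b') (s' \<otimes> t') = fraction R M (a \<otimes> b) (s \<otimes> t)"
    using C assms by (subst fraction_eq_iff) auto
qed

lemma add_fraction:
  assumes "a \<in> carrier R" "s \<in> M" "b \<in> carrier R" "t \<in> M"
  shows "fraction R M a s \<oplus>\<^bsub>localization R M\<^esub> fraction R M b t =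
    fraction R M (a \<otimes> t \<oplus> b \<otimes> s) (s \<otimes> t)"
  unfolding localization_def ring_record_simps
proof (rule UN_fraction2[OF assms])
  fix a' s' b' t' assume "(a', s') \<in> fraction R M a s" "(b', t') \<in> fraction R M b t"
  then obtain u v where C: "a' \<in> carrier R" "b' \<in> carrier R" "s' \<in> M" "t' \<in> M" "u \<in> M" "v \<in> M"
    and u: "u \<otimes> (a \<otimes> s') = u \<otimes> (a' \<otimes> s)" and v: "v \<otimes> (b \<otimes> t') = v \<otimes> (b' \<otimes> t)"
    unfolding mem_fraction_iff by blast
  have "(u \<otimes> v) \<otimes> ((a' \<otimes> t' \<oplus> b' \<otimes> s') \<otimes> (s \<otimes> t)) =
      (u \<otimes> (a' \<otimes> s)) \<otimes> (v \<otimes> (t' \<otimes> t)) \<oplus> (v \<otimes> (b' \<otimes> t)) \<otimes> (u \<otimes> (s' \<otimes> s))"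
    using C assms by (simp add: m_ac l_distr r_distr)
  also have "\<dots> = (u \<otimes> v) \<otimes> ((a \<otimes> t \<oplus> b \<otimes> s) \<otimes> (s' \<otimes> t'))"
    unfolding u[symmetric] v[symmetric] using C assms by (simp add: m_ac l_distr r_distr)
  finally show "fraction R M (a' \<otimes> t' \<oplus> b' \<otimes> s') (s' \<otimes> t') =
      fraction R M (a \<otimes> t \<oplus> b \<otimes> s) (s \<otimes> t)"
    using C assms by (subst fraction_eq_iff) auto
qed

lemma carrier_localization:
  "carrier (localization R M) = {fraction R M a s | a s. a \<in> carrier R \<and> s \<in> M}"
  by (simp add: localization_def)

lemma fraction_closed [simp, intro]:
  "a \<in> carrier R \<Longrightarrow> s \<in> M \<Longrightarrow> fraction R M a s \<in> carrier (localization R M)"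
  unfolding carrier_localization by blast

lemma carrier_localizationE:
  assumes "x \<in> carrier (localization R M)"
  obtains a s where "a \<in> carrier R" "s \<in> M" "x = fraction R M a s"
  using assms unfolding carrier_localization by blast

lemma one_localization: "\<one>\<^bsub>localization R M\<^esub> = fraction R M \<one> \<one>"
  and zero_localization: "\<zero>\<^bsub>localization R M\<^esub> = fraction R M \<zero> \<one>"
  by (simp_all add: localization_def)

theorem cring_localization: "cring (localization R M)"
proof (intro cringI abelian_groupI comm_monoidI)
  let ?L = "localization R M"
  fix x y assume "x \<in> carrier ?L" "y \<in> carrier ?L"
  then obtain a s b t where [simp]: "a \<in> carrier R" "s \<in> M" "b \<in> carrier R" "t \<in> M"
    and xy: "x = fraction R M a s" "y = fraction R M b t"
    by (metis carrier_localizationE)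
  show "x \<oplus>\<^bsub>?L\<^esub> y \<in> carrier ?L" "x \<otimes>\<^bsub>?L\<^esub> y \<in> carrier ?L"
    by (simp_all add: xy add_fraction mult_fraction)
  show "x \<oplus>\<^bsub>?L\<^esub> y = y \<oplus>\<^bsub>?L\<^esub> x" "x \<otimes>\<^bsub>?L\<^esub> y = y \<otimes>\<^bsub>?L\<^esub> x"
    by (simp_all add: xy add_fraction mult_fraction m_comm a_comm)
  show "\<zero>\<^bsub>?L\<^esub> \<oplus>\<^bsub>?L\<^esub> x = x" "\<one>\<^bsub>?L\<^esub> \<otimes>\<^bsub>?L\<^esub> x = x"
    by (simp_all add: xy zero_localization one_localization add_fraction mult_fraction)
  have "fraction R M (\<ominus> a) s \<oplus>\<^bsub>?L\<^esub> x = \<zero>\<^bsub>?L\<^esub>"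
    unfolding zero_localization xy by (simp add: add_fraction) (rule fraction_eqI, auto simp: l_minus l_neg)
  then show "\<exists>y\<in>carrier ?L. y \<oplus>\<^bsub>?L\<^esub> x = \<zero>\<^bsub>?L\<^esub>"
    by (rule bexI) simp
  fix z assume "z \<in> carrier ?L"
  then obtain c r where [simp]: "c \<in> carrier R" "r \<in> M" and z: "z = fraction R M c r"
    by (metis carrier_localizationE)
  show "x \<oplus>\<^bsub>?L\<^esub> y \<oplus>\<^bsub>?L\<^esub> z = x \<oplus>\<^bsub>?L\<^esub> (y \<oplus>\<^bsub>?L\<^esub> z)"
    by (simp add: xy z add_fraction) (rule fraction_eqI, auto simp: l_distr r_distr m_ac a_ac)
  show "x \<otimes>\<^bsub>?L\<^esub> y \<otimes>\<^bsub>?L\<^esub> z = x \<otimes>\<^bsub>?L\<^esub> (y \<otimes>\<^bsub>?L\<^esub> z)"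
    by (simp add: xy z mult_fraction m_ac)
  show "(x \<oplus>\<^bsub>?L\<^esub> y) \<otimes>\<^bsub>?L\<^esub> z = x \<otimes>\<^bsub>?L\<^esub> z \<oplus>\<^bsub>?L\<^esub> y \<otimes>\<^bsub>?L\<^esub> z"
    by (simp add: xy z mult_fraction add_fraction) (rule fraction_eqI, auto simp: l_distr r_distr m_ac)
qed (simp_all add: zero_localization one_localization)

lemma fraction_hom: "(\<lambda>a. fraction R M a \<one>) \<in> ring_hom R (localization R M)"
  by (rule ring_hom_memI) (auto simp: mult_fraction add_fraction one_localization)

lemma fraction_mult_denominator:
  assumes "a \<in> carrier R" "s \<in> M"
  shows "fraction R M a s \<otimes>\<^bsub>localization R M\<^esub> fraction R M s \<one> = fraction R M a \<one>"
  using assms by (simp add: mult_fraction) (rule fraction_eqI, auto)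

lemma denominator_inverse:
  assumes "s \<in> M"
  shows "fraction R M \<one> s \<otimes>\<^bsub>localization R M\<^esub> fraction R M s \<one> = \<one>\<^bsub>localization R M\<^esub>"
  using assms by (simp add: fraction_mult_denominator one_localization)

text \<open>
  The universal property of localization: \<open>a/s \<mapsto> h a (h s)\<^sup>-\<^sup>1\<close> is well defined because a factor
  \<open>u \<in> M\<close> that witnesses the equality of two fractions becomes a unit and can be cancelled.
\<close>

theorem extend_to_localization:
  assumes T: "cring T" and h: "h \<in> ring_hom R T" and units: "h ` M \<subseteq> Units T"
  obtains \<Phi> where "\<Phi> \<in> ring_hom (localization R M) T"
    "\<And>a. a \<in> carrier R \<Longrightarrow> \<Phi> (fraction R M a \<one>) = h a"
proof -
  interpret T: cring T by fact
  interpret h: ring_hom_cring R T h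
    by (intro ring_hom_cring.intro ring_hom_cring_axioms.intro T h cring_axioms)
  define q where "q = (\<lambda>(a, s). h a \<otimes>\<^bsub>T\<^esub> inv\<^bsub>T\<^esub> h s)"
  define \<Phi> where "\<Phi> x = q (SOME as. as \<in> x)" for x
  have U [simp]: "h s \<in> Units T" if "s \<in> M" for s using units that by blast
  have hC [simp]: "h s \<in> carrier T" if "s \<in> M" for s using that by simp
  have q_mult: "q (a, s) \<otimes>\<^bsub>T\<^esub> h s = h a" if "a \<in> carrier R" "s \<in> M" for a s
    using that by (simp add: q_def T.m_assoc)
  have q_closed [simp]: "q (a, s) \<in> carrier T" if "a \<in> carrier R" "s \<in> M" for a s
    using that by (simp add: q_def)
  have q_eqI: "q (a, s) = y" if "a \<in> carrier R" "s \<in> M" "y \<in> carrier T" "y \<otimes>\<^bsub>T\<^esub> h s = h a" for a s y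
    using q_mult[OF that(1,2)] that U[OF that(2)]
    by (metis T.Units_r_inv T.Units_inv_closed T.m_assoc T.r_one hC q_closed)
  have \<Phi>: "\<Phi> (fraction R M a s) = q (a, s)" if as: "a \<in> carrier R" "s \<in> M" for a s
  proof -
    define p where "p = (SOME as. as \<in> fraction R M a s)"
    obtain b t where p: "p = (b, t)" by fastforce
    have "(b, t) \<in> fraction R M a s"
      using someI[of "\<lambda>x. x \<in> fraction R M a s", OF mem_fraction_refl[OF as]] p p_def by simp
    then obtain u where C: "b \<in> carrier R" "t \<in> M" "u \<in> M" and u: "u \<otimes> (a \<otimes> t) = u \<otimes> (b \<otimes> s)"
      unfolding mem_fraction_iff by blast
    have "h u \<otimes>\<^bsub>T\<^esub> (h a \<otimes>\<^bsub>T\<^esub> h t) = h u \<otimes>\<^bsub>T\<^esub> (h b \<otimes>\<^bsub>T\<^esub> h s)"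
      using arg_cong[OF u, of h] C as by simp
    then have e: "h a \<otimes>\<^bsub>T\<^esub> h t = h b \<otimes>\<^bsub>T\<^esub> h s"
      using C as U T.Units_l_cancel by (metis T.m_closed h.hom_closed hC)
    have "q (b, t) \<otimes>\<^bsub>T\<^esub> h s \<otimes>\<^bsub>T\<^esub> h t = h a \<otimes>\<^bsub>T\<^esub> h t"
      unfolding e q_mult[OF C(1,2), symmetric] using C as by (simp add: T.m_ac)
    then have "q (b, t) \<otimes>\<^bsub>T\<^esub> h s = h a"
      using C as U[OF C(2)] T.Units_l_cancel[OF U[OF C(2)]] T.m_comm
      by (metis T.m_closed h.hom_closed hC q_closed)
    then have "q (a, s) = q (b, t)" using q_eqI as C q_closed by simp
    then show ?thesis unfolding \<Phi>_def p_def[symmetric] p by simp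
  qed
  have "\<Phi> \<in> ring_hom (localization R M) T"
  proof (rule ring_hom_memI)
    fix x y assume "x \<in> carrier (localization R M)" "y \<in> carrier (localization R M)"
    then obtain a s b t where C [simp]: "a \<in> carrier R" "s \<in> M" "b \<in> carrier R" "t \<in> M"
      and xy: "x = fraction R M a s" "y = fraction R M b t"
      by (metis carrier_localizationE)
    note m = q_mult[OF C(1,2), symmetric] q_mult[OF C(3,4), symmetric]
    show "\<Phi> x \<in> carrier T" by (simp add: xy \<Phi>)
    have "q (a, s) \<otimes>\<^bsub>T\<^esub> q (b, t) \<otimes>\<^bsub>T\<^esub> h (s \<otimes> t) = h (a \<otimes> b)"
      by (simp add: m) (simp add: T.m_ac)
    then have "q (a \<otimes> b, s \<otimes> t) = q (a, s) \<otimes>\<^bsub>T\<^esub> q (b, t)"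
      by (intro q_eqI) auto
    then show "\<Phi> (x \<otimes>\<^bsub>localization R M\<^esub> y) = \<Phi> x \<otimes>\<^bsub>T\<^esub> \<Phi> y"
      by (simp add: xy \<Phi> mult_fraction)
    have "(q (a, s) \<oplus>\<^bsub>T\<^esub> q (b, t)) \<otimes>\<^bsub>T\<^esub> h (s \<otimes> t) = h (a \<otimes> t \<oplus> b \<otimes> s)"
      by (simp add: m) (simp add: T.m_ac T.l_distr T.r_distr)
    then have "q (a \<otimes> t \<oplus> b \<otimes> s, s \<otimes> t) = q (a, s) \<oplus>\<^bsub>T\<^esub> q (b, t)"
      by (intro q_eqI) auto
    then show "\<Phi> (x \<oplus>\<^bsub>localization R M\<^esub> y) = \<Phi> x \<oplus>\<^bsub>T\<^esub> \<Phi> y"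
      by (simp add: xy \<Phi> add_fraction)
  next
    show "\<Phi> \<one>\<^bsub>localization R M\<^esub> = \<one>\<^bsub>T\<^esub>"
      unfolding one_localization by (simp add: \<Phi> q_def)
  qed
  moreover have "\<Phi> (fraction R M a \<one>) = h a" if "a \<in> carrier R" for a
    using that by (simp add: \<Phi> q_def)
  ultimately show thesis using that by blast
qed

text \<open>
  Uniqueness in the universal property: \<open>f (a/s) f (s/1) = f (a/1)\<close>, and \<open>f (s/1)\<close> is a unit.
\<close>

lemma hom_localization_eqI:
  assumes "cring T" "f \<in> ring_hom (localization R M) T" "g \<in> ring_hom (localization R M) T"
    and eq: "\<And>a. a \<in> carrier R \<Longrightarrow> f (fraction R M a \<one>) = g (fraction R M a \<one>)"
    and x: "x \<in> carrier (localization R M)"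
  shows "f x = g x"
proof -
  interpret L: cring "localization R M" by (rule cring_localization)
  interpret T: cring T by fact
  interpret f: ring_hom_cring "localization R M" T f
    by (intro ring_hom_cring.intro ring_hom_cring_axioms.intro assms cring_localization)
  interpret g: ring_hom_cring "localization R M" T g
    by (intro ring_hom_cring.intro ring_hom_cring_axioms.intro assms cring_localization)
  obtain a s where as [simp]: "a \<in> carrier R" "s \<in> M" and x: "x = fraction R M a s"
    using x by (rule carrier_localizationE)
  let ?d = "f (fraction R M s \<one>)" and ?i = "f (fraction R M \<one> s)"
  have "f x \<otimes>\<^bsub>T\<^esub> ?d = f (fraction R M a \<one>)" "g x \<otimes>\<^bsub>T\<^esub> ?d = g (fraction R M a \<one>)"
    unfolding x using fraction_mult_denominator[OF as] eq[of s]
    by (metis as carr f.hom_mult fraction_closed one_mem, metis as carr g.hom_mult fraction_closed one_mem)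
  then have e: "f x \<otimes>\<^bsub>T\<^esub> ?d = g x \<otimes>\<^bsub>T\<^esub> ?d" using eq[of a] by simp
  have di: "?d \<otimes>\<^bsub>T\<^esub> ?i = \<one>\<^bsub>T\<^esub>"
    using denominator_inverse[OF as(2)]
    by (metis T.m_comm as carr f.hom_closed f.hom_mult f.hom_one fraction_closed one_closed one_mem)
  have "f x = f x \<otimes>\<^bsub>T\<^esub> (?d \<otimes>\<^bsub>T\<^esub> ?i)" "g x = g x \<otimes>\<^bsub>T\<^esub> (?d \<otimes>\<^bsub>T\<^esub> ?i)"
    unfolding di x by simp_all
  then show ?thesis using e
    by (metis T.m_assoc as carr f.hom_closed g.hom_closed fraction_closed one_closed one_mem x)
qed

end

end

lemma multiplicative_subset_powers:
  assumes "cring R" "f \<in> carrier R"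
  shows "multiplicative_subset R (powers R f)"
proof -
  interpret cring R by fact
  show ?thesis
  proof unfold_locales
    show "\<one>\<^bsub>R\<^esub> \<in> powers R f" by (auto simp: powers_def intro!: exI[of _ "0::nat"])
    show "s \<otimes>\<^bsub>R\<^esub> t \<in> powers R f" if "s \<in> powers R f" "t \<in> powers R f" for s t
      using that assms(2) unfolding powers_def by (auto simp: nat_pow_mult)
  qed (use assms(2) in \<open>auto simp: powers_def\<close>)
qed


section \<open>Spectra\<close>

lemma openin_zariski: "openin (zariski R) = zariski_open R"
  by (simp add: zariski_def istopology_zariski_open topology_inverse')

lemma zariski_open_subset: "zariski_open R U \<Longrightarrow> U \<subseteq> primes R"
  unfolding zariski_open_def by blast

lemma multiplicative_subset_prime_complement:
  assumes "p \<in> primes R"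
  shows "multiplicative_subset R (carrier R - p)"
proof -
  interpret primeideal p R using assms by (simp add: primes_def)
  show ?thesis
  proof unfold_locales
    show "\<one>\<^bsub>R\<^esub> \<in> carrier R - p" using one_imp_carrier I_notcarr by auto
  qed (use I_prime in auto)
qed

lemma topspace_zariski [simp]: "topspace (zariski R) = primes R"
proof
  show "topspace (zariski R) \<subseteq> primes R"
    unfolding topspace_def openin_zariski using zariski_open_subset by blast
  have "zariski_open R (primes R)"
    unfolding zariski_open_def
  proof (intro exI conjI)
    show "primes R = {p \<in> primes R. \<not> carrier R \<subseteq> p}"
      using multiplicative_subset.one_mem[OF multiplicative_subset_prime_complement] by blast
  qed simp
  then show "primes R \<subseteq> topspace (zariski R)"
    unfolding topspace_def openin_zariski by blast
qed

lemma zariski_open_nonvanishing: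
  assumes "a \<in> carrier R"
  shows "zariski_open R {p \<in> primes R. a \<notin> p}"
  unfolding zariski_open_def using assms by (intro exI[of _ "{a}"]) auto

lemma zariski_open_Int: "zariski_open R U \<Longrightarrow> zariski_open R V \<Longrightarrow> zariski_open R (U \<inter> V)"
  using openin_Int[of "zariski R" U V] by (simp add: openin_zariski)

lemma Spec_simps [simp]:
  "sp (Spec R) = zariski R" "sec (Spec R) = structure_ring R" "res (Spec R) U V s = restrict s V"
  by (simp_all add: Spec_def)

lemma structure_ring_simps [simp]:
  "carrier (structure_ring R U) = sections R U"
  "s \<otimes>\<^bsub>structure_ring R U\<^esub> t = (\<lambda>p\<in>U. s p \<otimes>\<^bsub>stalk_at R p\<^esub> t p)"
  "\<one>\<^bsub>structure_ring R U\<^esub> = (\<lambda>p\<in>U. \<one>\<^bsub>stalk_at R p\<^esub>)"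
  "s \<oplus>\<^bsub>structure_ring R U\<^esub> t = (\<lambda>p\<in>U. s p \<oplus>\<^bsub>stalk_at R p\<^esub> t p)"
  by (simp_all add: structure_ring_def)

context
  fixes R :: "('a, 'm) ring_scheme" (structure) and p
  assumes p: "p \<in> primes R"
begin

interpretation multiplicative_subset R "carrier R - p"
  by (rule multiplicative_subset_prime_complement[OF p])

lemma stalk_closed:
  "a \<in> carrier R \<Longrightarrow> g \<in> carrier R \<Longrightarrow> g \<notin> p \<Longrightarrow> fraction_at R p a g \<in> carrier (stalk_at R p)"
  by (simp add: fraction_at_def stalk_at_def)

lemma stalkE:
  assumes "x \<in> carrier (stalk_at R p)"
  obtains a g where "a \<in> carrier R" "g \<in> carrier R" "g \<notin> p" "x = fraction_at R p a g"
  using assms carrier_localizationE unfolding fraction_at_def stalk_at_def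
  by (metis DiffE)

lemma stalk_mult:
  "\<lbrakk>a \<in> carrier R; g \<in> carrier R; g \<notin> p; b \<in> carrier R; h \<in> carrier R; h \<notin> p\<rbrakk> \<Longrightarrow>
    fraction_at R p a g \<otimes>\<^bsub>stalk_at R p\<^esub> fraction_at R p b h = fraction_at R p (a \<otimes> b) (g \<otimes> h)"
  by (simp add: fraction_at_def stalk_at_def mult_fraction)

lemma stalk_add:
  "\<lbrakk>a \<in> carrier R; g \<in> carrier R; g \<notin> p; b \<in> carrier R; h \<in> carrier R; h \<notin> p\<rbrakk> \<Longrightarrow>
    fraction_at R p a g \<oplus>\<^bsub>stalk_at R p\<^esub> fraction_at R p b h =
      fraction_at R p (a \<otimes> h \<oplus> b \<otimes> g) (g \<otimes> h)"
  by (simp add: fraction_at_def stalk_at_def add_fraction)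

lemma stalk_one: "\<one>\<^bsub>stalk_at R p\<^esub> = fraction_at R p \<one> \<one>"
  by (simp add: fraction_at_def stalk_at_def one_localization)

lemma stalk_inverse:
  assumes "a \<in> carrier R" "g \<in> carrier R" "g \<notin> p" "a \<notin> p"
  shows "fraction_at R p a g \<otimes>\<^bsub>stalk_at R p\<^esub> fraction_at R p g a = \<one>\<^bsub>stalk_at R p\<^esub>"
    and "fraction_at R p g a \<otimes>\<^bsub>stalk_at R p\<^esub> fraction_at R p a g = \<one>\<^bsub>stalk_at R p\<^esub>"
proof -
  have m: "a \<otimes> g \<in> carrier R - p" by (rule mult_mem) (use assms in auto)
  have "fraction R (carrier R - p) (a \<otimes> g) (a \<otimes> g) = fraction R (carrier R - p) \<one> \<one>"
    by (rule fraction_eqI[OF _ _ m one_mem]) (use assms in auto)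
  then show "fraction_at R p a g \<otimes>\<^bsub>stalk_at R p\<^esub> fraction_at R p g a = \<one>\<^bsub>stalk_at R p\<^esub>"
    and "fraction_at R p g a \<otimes>\<^bsub>stalk_at R p\<^esub> fraction_at R p a g = \<one>\<^bsub>stalk_at R p\<^esub>"
    using assms m_comm[of a g] by (simp_all add: stalk_mult stalk_one) (simp_all add: fraction_at_def)
qed

text \<open>
  If \<open>a/g\<close> has the inverse \<open>b/h\<close> in the local ring, then \<open>u a b = u g h\<close> for some \<open>u\<close> outside the prime
  ideal \<open>p\<close>; the right-hand side is not in \<open>p\<close>, so neither is \<open>a\<close>.
\<close>

lemma unit_in_stalk_numerator:
  assumes "a \<in> carrier R" "g \<in> carrier R" "g \<notin> p" "x \<in> carrier (stalk_at R p)"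
    and eq: "fraction_at R p a g \<otimes>\<^bsub>stalk_at R p\<^esub> x = \<one>\<^bsub>stalk_at R p\<^esub>"
  shows "a \<notin> p"
proof
  assume "a \<in> p"
  interpret primeideal p R using p by (simp add: primes_def)
  obtain b h where bh: "b \<in> carrier R" "h \<in> carrier R" "h \<notin> p" "x = fraction_at R p b h"
    using assms(4) by (rule stalkE)
  have gh: "g \<otimes> h \<in> carrier R - p" by (rule mult_mem) (use assms bh in auto)
  have "fraction_at R p (a \<otimes> b) (g \<otimes> h) = fraction_at R p \<one> \<one>"
    using eq stalk_mult[of a g b h] assms bh by (simp add: stalk_one)
  then have "\<exists>u\<in>carrier R - p. u \<otimes> (a \<otimes> b \<otimes> \<one>) = u \<otimes> (\<one> \<otimes> (g \<otimes> h))"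
    unfolding fraction_at_def
    by (rule fraction_eq_iff[THEN iffD1, OF _ _ gh one_mem, rotated 2]) (use assms(1) bh(1) in auto)
  then obtain u where u: "u \<in> carrier R - p" "u \<otimes> (a \<otimes> b) = u \<otimes> (g \<otimes> h)"
    using assms bh by auto
  have "u \<otimes> (a \<otimes> b) \<in> p"
    using \<open>a \<in> p\<close> bh(1) u(1) by (intro I_l_closed I_r_closed) auto
  moreover have "u \<otimes> (g \<otimes> h) \<in> carrier R - p"
    by (rule mult_mem[OF u(1) gh])
  ultimately show False using u(2) by simp
qed

end

lemma sectionsI:
  assumes "s \<in> extensional U"
    and "\<And>p. p \<in> U \<Longrightarrow> \<exists>V a g. zariski_open R V \<and> p \<in> V \<and> V \<subseteq> U \<and> a \<in> carrier R \<and> g \<in> carrier R \<and>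
      (\<forall>q\<in>V. g \<notin> q \<and> s q = fraction_at R q a g)"
  shows "s \<in> sections R U"
proof -
  have "s p \<in> carrier (stalk_at R p)" if p: "p \<in> U" for p
  proof -
    obtain V a g where "zariski_open R V" "p \<in> V" "a \<in> carrier R" "g \<in> carrier R"
      "g \<notin> p" "s p = fraction_at R p a g"
      using assms(2)[OF p] by blast
    then show ?thesis using stalk_closed[of p R a g] zariski_open_subset[of R V] by auto
  qed
  then have "s \<in> (\<Pi>\<^sub>E p\<in>U. carrier (stalk_at R p))"
    using assms(1) by (simp add: PiE_iff)
  then show ?thesis
    unfolding sections_def openin_zariski
  proof (intro CollectI conjI ballI)
    fix p assume "p \<in> U"
    from assms(2)[OF this] show "\<exists>V. zariski_open R V \<and> p \<in> V \<and> V \<subseteq> U \<and>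
        (\<exists>a\<in>carrier R. \<exists>g\<in>carrier R. \<forall>q\<in>V. g \<notin> q \<and> s q = fraction_at R q a g)"
      by blast
  qed
qed

lemma sections_locally_fraction:
  assumes "s \<in> sections R U" "p \<in> U"
  obtains V a g where "zariski_open R V" "p \<in> V" "V \<subseteq> U" "a \<in> carrier R" "g \<in> carrier R"
    "\<And>q. q \<in> V \<Longrightarrow> g \<notin> q" "\<And>q. q \<in> V \<Longrightarrow> s q = fraction_at R q a g"
proof -
  have "\<exists>V. zariski_open R V \<and> p \<in> V \<and> V \<subseteq> U \<and>
      (\<exists>a\<in>carrier R. \<exists>g\<in>carrier R. \<forall>q\<in>V. g \<notin> q \<and> s q = fraction_at R q a g)"
    using assms by (simp add: sections_def openin_zariski)
  then show thesis using that by (elim exE conjE bexE) blast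
qed

lemma sections_value: "s \<in> sections R U \<Longrightarrow> p \<in> U \<Longrightarrow> s p \<in> carrier (stalk_at R p)"
  unfolding sections_def by auto

lemma sections_extensional: "s \<in> sections R U \<Longrightarrow> s \<in> extensional U"
  unfolding sections_def by (auto simp: PiE_iff)


section \<open>The morphism of spectra of a ring homomorphism\<close>

lemma contract_prime:
  assumes "cring A" "\<phi> \<in> ring_hom A B" "q \<in> primes B"
  shows "contract A \<phi> q \<in> primes A"
proof -
  interpret A: cring A by fact
  interpret q: primeideal q B using assms by (simp add: primes_def)
  interpret ring_hom_ring A B \<phi>
    by (intro ring_hom_ringI2 A.ring_axioms q.ring_axioms assms)
  show ?thesis
    using primeideal_vimage[OF A.cring_axioms q.primeideal] by (simp add: primes_def contract_def)
qed

lemma preimg_Spec: "preimg (Spec B) f V = {q \<in> primes B. f q \<in> V}"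
  by (simp add: preimg_def)

text \<open>The preimage of the complement of \<open>V(E)\<close> is the complement of \<open>V(\<phi>(E))\<close>.\<close>

lemma zariski_open_preimg:
  assumes "cring A" "\<phi> \<in> ring_hom A B" "zariski_open A V"
  shows "zariski_open B (preimg (Spec B) (contract A \<phi>) V)"
proof -
  obtain E where E: "E \<subseteq> carrier A" "V = {p \<in> primes A. \<not> E \<subseteq> p}"
    using assms(3) unfolding zariski_open_def by blast
  have "\<phi> ` E \<subseteq> carrier B" using E(1) assms(2) by (auto simp: ring_hom_closed)
  moreover have "preimg (Spec B) (contract A \<phi>) V = {q \<in> primes B. \<not> \<phi> ` E \<subseteq> q}"
    unfolding preimg_Spec E(2) using E(1) contract_prime[OF assms(1,2)] by (auto simp: contract_def)
  ultimately show ?thesis unfolding zariski_open_def by blast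
qed

lemma notin_contract: "g \<in> carrier A \<Longrightarrow> g \<notin> contract A \<phi> q \<longleftrightarrow> \<phi> g \<notin> q"
  by (simp add: contract_def)

lemma stalk_map_fraction:
  assumes A: "cring A" and \<phi>: "\<phi> \<in> ring_hom A B" and q: "q \<in> primes B"
    and a: "a \<in> carrier A" and g: "g \<in> carrier A" "\<phi> g \<notin> q"
  shows "stalk_map B \<phi> q (fraction_at A (contract A \<phi> q) a g) = fraction_at B q (\<phi> a) (\<phi> g)"
proof -
  let ?p = "contract A \<phi> q"
  interpret p: multiplicative_subset A "carrier A - ?p"
    by (rule multiplicative_subset_prime_complement[OF contract_prime[OF A \<phi> q]])
  interpret q: multiplicative_subset B "carrier B - q"
    by (rule multiplicative_subset_prime_complement[OF q])
  interpret \<phi>: ring_hom_cring A B \<phi>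
    by (intro ring_hom_cring.intro ring_hom_cring_axioms.intro \<phi> A q.cring_axioms)
  show ?thesis
    unfolding stalk_map_def fraction_at_def
  proof (rule p.UN_fraction)
    fix b h assume "(b, h) \<in> fraction A (carrier A - ?p) a g"
    then obtain u where C: "b \<in> carrier A" "h \<in> carrier A" "h \<notin> ?p" "u \<in> carrier A" "u \<notin> ?p"
      and u: "u \<otimes>\<^bsub>A\<^esub> (a \<otimes>\<^bsub>A\<^esub> h) = u \<otimes>\<^bsub>A\<^esub> (b \<otimes>\<^bsub>A\<^esub> g)"
      unfolding p.mem_fraction_iff by blast
    have "\<phi> u \<otimes>\<^bsub>B\<^esub> (\<phi> b \<otimes>\<^bsub>B\<^esub> \<phi> g) = \<phi> u \<otimes>\<^bsub>B\<^esub> (\<phi> a \<otimes>\<^bsub>B\<^esub> \<phi> h)"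
      using arg_cong[OF u, of \<phi>] C a g by simp
    moreover have "\<phi> u \<in> carrier B - q" using C by (auto simp: contract_def)
    ultimately show "fraction B (carrier B - q) (\<phi> b) (\<phi> h) = fraction B (carrier B - q) (\<phi> a) (\<phi> g)"
      using C a g notin_contract[of h A \<phi> q] by (subst q.fraction_eq_iff) auto
  qed (use a g in \<open>auto simp: contract_def\<close>)
qed

lemma stalk_map_hom:
  assumes A: "cring A" and \<phi>: "\<phi> \<in> ring_hom A B" and q: "q \<in> primes B"
  shows "stalk_map B \<phi> q \<in> ring_hom (stalk_at A (contract A \<phi> q)) (stalk_at B q)"
proof -
  let ?p = "contract A \<phi> q"
  have p: "?p \<in> primes A" using contract_prime[OF A \<phi> q] .
  interpret pm: multiplicative_subset A "carrier A - ?p"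
    by (rule multiplicative_subset_prime_complement[OF p])
  interpret qm: multiplicative_subset B "carrier B - q"
    by (rule multiplicative_subset_prime_complement[OF q])
  interpret \<phi>: ring_hom_cring A B \<phi>
    by (intro ring_hom_cring.intro ring_hom_cring_axioms.intro \<phi> A qm.cring_axioms)
  note sm = stalk_map_fraction[OF A \<phi> q]
  show ?thesis
  proof (rule ring_hom_memI)
    fix x y assume "x \<in> carrier (stalk_at A ?p)" "y \<in> carrier (stalk_at A ?p)"
    then obtain a g b h where C: "a \<in> carrier A" "g \<in> carrier A" "g \<notin> ?p"
      "b \<in> carrier A" "h \<in> carrier A" "h \<notin> ?p"
      and xy: "x = fraction_at A ?p a g" "y = fraction_at A ?p b h"
      by (metis stalkE[OF p])
    have D: "\<phi> g \<notin> q" "\<phi> h \<notin> q" using C notin_contract by metis+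
    have "g \<otimes>\<^bsub>A\<^esub> h \<notin> ?p" using pm.mult_mem[of g h] C by blast
    then have E: "\<phi> g \<otimes>\<^bsub>B\<^esub> \<phi> h \<notin> q" using C notin_contract[of "g \<otimes>\<^bsub>A\<^esub> h" A \<phi> q] by simp
    show "stalk_map B \<phi> q x \<in> carrier (stalk_at B q)"
      using C D by (simp add: xy sm stalk_closed[OF q])
    show "stalk_map B \<phi> q (x \<otimes>\<^bsub>stalk_at A ?p\<^esub> y) =
        stalk_map B \<phi> q x \<otimes>\<^bsub>stalk_at B q\<^esub> stalk_map B \<phi> q y"
      using C D E by (simp add: xy sm stalk_mult[OF p] stalk_mult[OF q])
    show "stalk_map B \<phi> q (x \<oplus>\<^bsub>stalk_at A ?p\<^esub> y) =
        stalk_map B \<phi> q x \<oplus>\<^bsub>stalk_at B q\<^esub> stalk_map B \<phi> q y"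
      using C D E by (simp add: xy sm stalk_add[OF p] stalk_add[OF q])
  next
    have "\<one>\<^bsub>B\<^esub> \<notin> q" using qm.one_mem by blast
    then show "stalk_map B \<phi> q \<one>\<^bsub>stalk_at A ?p\<^esub> = \<one>\<^bsub>stalk_at B q\<^esub>"
      by (simp add: stalk_one[OF p] stalk_one[OF q] sm)
  qed
qed

lemma Spec_map_simps [simp]:
  "fst (Spec_map A B \<phi>) = contract A \<phi>"
  "snd (Spec_map A B \<phi>) V s =
    (\<lambda>q\<in>preimg (Spec B) (contract A \<phi>) V. stalk_map B \<phi> q (s (contract A \<phi> q)))"
  by (simp_all add: Spec_map_def)

lemma Spec_map_section:
  assumes A: "cring A" and \<phi>: "\<phi> \<in> ring_hom A B"
    and s: "s \<in> sections A V"
  shows "snd (Spec_map A B \<phi>) V s \<in> sections B (preimg (Spec B) (contract A \<phi>) V)"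
  unfolding Spec_map_simps
proof (rule sectionsI)
  let ?W = "\<lambda>V. preimg (Spec B) (contract A \<phi>) V"
  fix q assume q: "q \<in> ?W V"
  then have "contract A \<phi> q \<in> V" by (simp add: preimg_Spec)
  then obtain V' a g where V': "zariski_open A V'" "contract A \<phi> q \<in> V'" "V' \<subseteq> V"
    and ag: "a \<in> carrier A" "g \<in> carrier A"
    and s: "\<And>p. p \<in> V' \<Longrightarrow> g \<notin> p" "\<And>p. p \<in> V' \<Longrightarrow> s p = fraction_at A p a g"
    using sections_locally_fraction[OF s] by blast
  have W: "zariski_open B (?W V')" "q \<in> ?W V'" "?W V' \<subseteq> ?W V"
    using zariski_open_preimg[OF A \<phi> V'(1)] V'(2,3) q by (auto simp: preimg_Spec)
  have "\<phi> g \<notin> r \<and> (\<lambda>q\<in>?W V. stalk_map B \<phi> q (s (contract A \<phi> q))) r = fraction_at B r (\<phi> a) (\<phi> g)"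
    if r: "r \<in> ?W V'" for r
  proof -
    have "r \<in> primes B" "contract A \<phi> r \<in> V'" using r by (auto simp: preimg_Spec)
    moreover from this have "\<phi> g \<notin> r" using s(1) notin_contract ag(2) by metis
    ultimately show ?thesis
      using stalk_map_fraction[OF A \<phi>] s(2) ag W(3) r by auto
  qed
  then show "\<exists>V' a g. zariski_open B V' \<and> q \<in> V' \<and> V' \<subseteq> ?W V \<and> a \<in> carrier B \<and> g \<in> carrier B \<and>
      (\<forall>r\<in>V'. g \<notin> r \<and>
        (\<lambda>q\<in>?W V. stalk_map B \<phi> q (s (contract A \<phi> q))) r = fraction_at B r a g)"
    using W ag \<phi> by (intro exI[of _ "?W V'"] exI[of _ "\<phi> a"] exI[of _ "\<phi> g"]) (auto simp: ring_hom_closed)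
qed simp

text \<open>
  Invertibility of a germ is a condition on numerators: if \<open>s = a/g\<close> near \<open>x\<close> and \<open>a \<notin> x\<close>, then \<open>g/a\<close> is an
  inverse on the smaller neighbourhood where \<open>a\<close> does not vanish. This criterion makes it
  immediate that the homomorphisms on stalks are local.
\<close>

lemma germ_unit_Spec_iff:
  assumes s: "s \<in> sections R U" and x: "x \<in> U"
    and V: "zariski_open R V" "x \<in> V" "V \<subseteq> U" and ag: "a \<in> carrier R" "g \<in> carrier R"
    and frac: "\<And>q. q \<in> V \<Longrightarrow> g \<notin> q" "\<And>q. q \<in> V \<Longrightarrow> s q = fraction_at R q a g"
  shows "germ_unit (Spec R) x U s \<longleftrightarrow> a \<notin> x"
proof
  assume "germ_unit (Spec R) x U s"
  then obtain W t where W: "zariski_open R W" "x \<in> W" "W \<subseteq> U"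
    and t: "t \<in> sections R W" "restrict s W \<otimes>\<^bsub>structure_ring R W\<^esub> t = \<one>\<^bsub>structure_ring R W\<^esub>"
    unfolding germ_unit_def Units_def openin_zariski Spec_simps structure_ring_simps(1) by blast
  have "s x \<otimes>\<^bsub>stalk_at R x\<^esub> t x = \<one>\<^bsub>stalk_at R x\<^esub>"
    using fun_cong[OF t(2), of x] W(2) by simp
  then show "a \<notin> x"
    using unit_in_stalk_numerator[of x R a g "t x"] zariski_open_subset[OF V(1)] V(2) ag frac
      sections_value[OF t(1) W(2)] by auto
next
  assume a: "a \<notin> x"
  let ?W = "V \<inter> {p \<in> primes R. a \<notin> p}"
  have W: "zariski_open R ?W" "x \<in> ?W" "?W \<subseteq> U"
    using zariski_open_Int[OF V(1) zariski_open_nonvanishing[OF ag(1)]] V a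
      zariski_open_subset[OF V(1)] by auto
  let ?t = "\<lambda>p\<in>?W. fraction_at R p g a"
  have t: "?t \<in> sections R ?W"
    using W(1) ag by (intro sectionsI) (auto intro!: exI[of _ ?W])
  have s': "restrict s ?W \<in> sections R ?W"
    using W(1) ag frac by (intro sectionsI) (auto intro!: exI[of _ ?W])
  have "restrict s ?W \<otimes>\<^bsub>structure_ring R ?W\<^esub> ?t = \<one>\<^bsub>structure_ring R ?W\<^esub>"
    "?t \<otimes>\<^bsub>structure_ring R ?W\<^esub> restrict s ?W = \<one>\<^bsub>structure_ring R ?W\<^esub>"
    using frac ag by (auto simp: fun_eq_iff restrict_def stalk_inverse)
  then have "restrict s ?W \<in> Units (structure_ring R ?W)"
    using t s' unfolding Units_def structure_ring_simps(1) by blast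
  then show "germ_unit (Spec R) x U s"
    unfolding germ_unit_def openin_zariski Spec_simps using W by blast
qed

text \<open>
  Only the locality of the stalk maps needs an idea: near the image point \<open>\<phi>\<^sup>-\<^sup>1(x)\<close> a section is some
  \<open>a/g\<close>, and near \<open>x\<close> its image is \<open>\<phi>(a)/\<phi>(g)\<close>; the germs are units iff \<open>a \<notin> \<phi>\<^sup>-\<^sup>1(x)\<close> and \<open>\<phi>(a) \<notin> x\<close>
  respectively, which is the same condition.
\<close>

theorem lrs_morphism_Spec_map:
  assumes A: "cring A" and \<phi>: "\<phi> \<in> ring_hom A B"
  shows "lrs_morphism (Spec B) (Spec A) (Spec_map A B \<phi>)"
proof -
  let ?f = "contract A \<phi>" and ?h = "snd (Spec_map A B \<phi>)"
  let ?W = "\<lambda>V. preimg (Spec B) ?f V"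
  have "continuous_map (zariski B) (zariski A) ?f"
    unfolding continuous_map_def openin_zariski topspace_zariski
    using contract_prime[OF A \<phi>] zariski_open_preimg[OF A \<phi>] by (auto simp: preimg_Spec)
  moreover have "?h V \<in> ring_hom (structure_ring A V) (structure_ring B (?W V))"
    if V: "zariski_open A V" for V
  proof (rule ring_hom_memI)
    fix s t assume st: "s \<in> carrier (structure_ring A V)" "t \<in> carrier (structure_ring A V)"
    show "?h V s \<in> carrier (structure_ring B (?W V))"
      using Spec_map_section[OF A \<phi>] st(1) by simp
    have v: "s (?f q) \<in> carrier (stalk_at A (?f q))" "t (?f q) \<in> carrier (stalk_at A (?f q))"
      if "q \<in> ?W V" for q
      using that st sections_value by (auto simp: preimg_Spec)
    show "?h V (s \<otimes>\<^bsub>structure_ring A V\<^esub> t) = ?h V s \<otimes>\<^bsub>structure_ring B (?W V)\<^esub> ?h V t"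
      using v ring_hom_mult[OF stalk_map_hom[OF A \<phi>]]
      by (auto simp: fun_eq_iff restrict_def preimg_Spec)
    show "?h V (s \<oplus>\<^bsub>structure_ring A V\<^esub> t) = ?h V s \<oplus>\<^bsub>structure_ring B (?W V)\<^esub> ?h V t"
      using v ring_hom_add[OF stalk_map_hom[OF A \<phi>]]
      by (auto simp: fun_eq_iff restrict_def preimg_Spec)
  next
    show "?h V \<one>\<^bsub>structure_ring A V\<^esub> = \<one>\<^bsub>structure_ring B (?W V)\<^esub>"
      using ring_hom_one[OF stalk_map_hom[OF A \<phi>]]
      by (auto simp: fun_eq_iff restrict_def preimg_Spec)
  qed
  moreover have "?h W (restrict s W) = restrict (?h V s) (?W W)" if "W \<subseteq> V" for V W s
    using that by (auto simp: fun_eq_iff restrict_def preimg_Spec)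
  moreover have "germ_unit (Spec A) (?f x) V s"
    if x: "x \<in> primes B" "?f x \<in> V" and V: "zariski_open A V" and s: "s \<in> sections A V"
      and u: "germ_unit (Spec B) x (?W V) (?h V s)" for x V s
  proof -
    obtain V' a g where V': "zariski_open A V'" "?f x \<in> V'" "V' \<subseteq> V"
      and ag: "a \<in> carrier A" "g \<in> carrier A"
      and frac: "\<And>p. p \<in> V' \<Longrightarrow> g \<notin> p" "\<And>p. p \<in> V' \<Longrightarrow> s p = fraction_at A p a g"
      using sections_locally_fraction[OF s x(2)] by blast
    have frac': "\<phi> g \<notin> q" "?h V s q = fraction_at B q (\<phi> a) (\<phi> g)" if "q \<in> ?W V'" for q
    proof -
      have q: "q \<in> primes B" "?f q \<in> V'" using that by (auto simp: preimg_Spec)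
      then show g: "\<phi> g \<notin> q" using frac(1) notin_contract ag(2) by metis
      show "?h V s q = fraction_at B q (\<phi> a) (\<phi> g)"
        using q V'(3) frac(2) stalk_map_fraction[OF A \<phi> q(1) ag g] by (auto simp: preimg_Spec)
    qed
    have "germ_unit (Spec B) x (?W V) (?h V s) \<longleftrightarrow> \<phi> a \<notin> x"
      using x V' ag \<phi> frac' zariski_open_preimg[OF A \<phi> V'(1)]
      by (intro germ_unit_Spec_iff[where V = "?W V'" and g = "\<phi> g"] Spec_map_section[OF A \<phi> s])
        (auto simp: preimg_Spec ring_hom_closed)
    then have "a \<notin> ?f x" using u notin_contract[OF ag(1)] by metis
    then show ?thesis
      using germ_unit_Spec_iff[OF s x(2) V' ag frac] by blast
  qed
  ultimately show ?thesis
    unfolding lrs_morphism_def Spec_map_def[of A B \<phi>] split openin_zariski Spec_simps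
    by (simp add: Spec_map_def)
qed

lemma Spec_map_comp:
  assumes A: "cring A" and B: "cring B" and \<phi>: "\<phi> \<in> ring_hom A B" and \<theta>: "\<theta> \<in> ring_hom B C"
  shows "rs_eq (Spec C) (Spec A)
    (rs_comp (Spec B) (Spec_map A B \<phi>) (Spec_map B C \<theta>)) (Spec_map A C (\<theta> \<circ> \<phi>))"
proof -
  have c: "contract A \<phi> (contract B \<theta> q) = contract A (\<theta> \<circ> \<phi>) q" for q
    using \<phi> by (auto simp: contract_def ring_hom_closed)
  have p: "preimg (Spec C) (contract B \<theta>) (preimg (Spec B) (contract A \<phi>) V) =
      preimg (Spec C) (contract A (\<theta> \<circ> \<phi>)) V" for V
    using contract_prime[OF B \<theta>] by (auto simp: preimg_Spec c)
  have m: "stalk_map C \<theta> q (stalk_map B \<phi> (contract B \<theta> q) x) = stalk_map C (\<theta> \<circ> \<phi>) q x"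
    if q: "q \<in> primes C" and x: "x \<in> carrier (stalk_at A (contract A (\<theta> \<circ> \<phi>) q))" for q x
  proof -
    have \<theta>\<phi>: "\<theta> \<circ> \<phi> \<in> ring_hom A C" by (rule ring_hom_trans[OF \<phi> \<theta>])
    have r: "contract B \<theta> q \<in> primes B" using contract_prime[OF B \<theta> q] .
    obtain a g where ag: "a \<in> carrier A" "g \<in> carrier A" "g \<notin> contract A (\<theta> \<circ> \<phi>) q"
      and x: "x = fraction_at A (contract A (\<theta> \<circ> \<phi>) q) a g"
      using stalkE[OF contract_prime[OF A \<theta>\<phi> q] x] by blast
    have g: "\<theta> (\<phi> g) \<notin> q" "\<phi> g \<notin> contract B \<theta> q" using ag by (auto simp: contract_def)
    have "stalk_map B \<phi> (contract B \<theta> q) x = fraction_at B (contract B \<theta> q) (\<phi> a) (\<phi> g)"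
      using stalk_map_fraction[OF A \<phi> r ag(1,2) g(2)] by (simp add: c x)
    then show ?thesis
      using stalk_map_fraction[OF B \<theta> q, of "\<phi> a" "\<phi> g"] stalk_map_fraction[OF A \<theta>\<phi> q, of a g]
        ag g \<phi> by (simp add: x ring_hom_closed)
  qed
  show ?thesis
    unfolding rs_eq_def rs_comp_def Spec_map_simps fst_conv snd_conv comp_def[of "contract A \<phi>"] c
      comp_def[of "snd (Spec_map B C \<theta>) _"] p
  proof (intro conjI ballI allI impI refl)
    fix V s assume s: "s \<in> carrier (sec (Spec A) V)"
    have "contract B \<theta> q \<in> preimg (Spec B) (contract A \<phi>) V"
      if "q \<in> preimg (Spec C) (contract A (\<theta> \<circ> \<phi>)) V" for q
      using that contract_prime[OF B \<theta>] by (auto simp: preimg_Spec c)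
    moreover have "s (contract A (\<theta> \<circ> \<phi>) q) \<in> carrier (stalk_at A (contract A (\<theta> \<circ> \<phi>) q))"
      if "q \<in> preimg (Spec C) (contract A (\<theta> \<circ> \<phi>)) V" for q
      using that s sections_value by (auto simp: preimg_Spec)
    ultimately show "(\<lambda>q\<in>preimg (Spec C) (contract A (\<theta> \<circ> \<phi>)) V. stalk_map C \<theta> q
          ((\<lambda>q\<in>preimg (Spec B) (contract A \<phi>) V. stalk_map B \<phi> q (s (contract A \<phi> q)))
            (contract B \<theta> q))) =
        (\<lambda>q\<in>preimg (Spec C) (contract A (\<theta> \<circ> \<phi>)) V.
          stalk_map C (\<theta> \<circ> \<phi>) q (s (contract A (\<theta> \<circ> \<phi>) q)))"
      using m by (auto simp: fun_eq_iff restrict_def c preimg_Spec)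
  qed
qed

lemma Spec_map_cong:
  assumes A: "cring A" and \<phi>: "\<phi> \<in> ring_hom A B" and eq: "\<And>a. a \<in> carrier A \<Longrightarrow> \<phi> a = \<phi>' a"
  shows "rs_eq (Spec B) (Spec A) (Spec_map A B \<phi>) (Spec_map A B \<phi>')"
proof -
  have c: "contract A \<phi>' = contract A \<phi>"
    using eq by (auto simp: contract_def fun_eq_iff)
  have m: "stalk_map B \<phi>' q x = stalk_map B \<phi> q x"
    if q: "q \<in> primes B" and x: "x \<in> carrier (stalk_at A (contract A \<phi> q))" for q x
  proof -
    obtain a g where "a \<in> carrier A" "g \<in> carrier A" and x: "x = fraction_at A (contract A \<phi> q) a g"
      using stalkE[OF contract_prime[OF A \<phi> q] x] by blast
    have "b \<in> carrier A" "h \<in> carrier A" if "(b, h) \<in> x" for b h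
      using that unfolding x fraction_at_def fraction_def by auto
    then show ?thesis unfolding stalk_map_def by (intro SUP_cong) (auto simp: eq)
  qed
  show ?thesis
    unfolding rs_eq_def Spec_map_simps c
  proof (intro conjI ballI allI impI refl)
    fix V s assume s: "s \<in> carrier (sec (Spec A) V)"
    show "(\<lambda>q\<in>preimg (Spec B) (contract A \<phi>) V. stalk_map B \<phi> q (s (contract A \<phi> q))) =
        (\<lambda>q\<in>preimg (Spec B) (contract A \<phi>) V. stalk_map B \<phi>' q (s (contract A \<phi> q)))"
    proof (rule restrict_ext)
      fix q assume "q \<in> preimg (Spec B) (contract A \<phi>) V"
      then have "q \<in> primes B" "contract A \<phi> q \<in> V" by (auto simp: preimg_Spec)
      then show "stalk_map B \<phi> q (s (contract A \<phi> q)) = stalk_map B \<phi>' q (s (contract A \<phi> q))"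
        using m[of q "s (contract A \<phi> q)"] sections_value[of s A V "contract A \<phi> q"] s by simp
    qed
  qed
qed

lemma Spec_map_id:
  assumes A: "cring A"
  shows "rs_eq (Spec A) (Spec A) (Spec_map A A id) rs_id"
proof -
  have \<phi>: "id \<in> ring_hom A A" by (auto intro: ring_hom_memI)
  have c: "contract A id q = q" if "q \<in> primes A" for q
  proof -
    interpret primeideal q A using that by (simp add: primes_def)
    show ?thesis using a_subset by (auto simp: contract_def)
  qed
  show ?thesis
    unfolding rs_eq_def Spec_map_simps openin_zariski Spec_simps structure_ring_simps topspace_zariski rs_id_def
  proof (intro conjI ballI allI impI; simp add: c)
    fix V s assume V: "zariski_open A V" and s: "s \<in> sections A V"
    have p: "preimg (Spec A) (contract A id) V = V"
      using zariski_open_subset[OF V] c by (auto simp: preimg_Spec)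
    have "stalk_map A id q (s (contract A id q)) = s q" if q: "q \<in> V" for q
    proof -
      have q': "q \<in> primes A" using q zariski_open_subset[OF V] by blast
      obtain a g where "a \<in> carrier A" "g \<in> carrier A" "g \<notin> q" "s q = fraction_at A q a g"
        using stalkE[OF q' sections_value[OF s q]] by blast
      then show ?thesis using stalk_map_fraction[OF A \<phi> q', of a g] c[OF q'] by simp
    qed
    then show "(\<lambda>q\<in>preimg (Spec A) (contract A id) V. stalk_map A id q (s (contract A id q))) = s"
      using sections_extensional[OF s] by (auto simp: p fun_eq_iff restrict_def extensional_def)
  qed
qed

lemma rs_eq_sym: "rs_eq Xs Ys F G \<Longrightarrow> rs_eq Xs Ys G F"
  by (simp add: rs_eq_def)

lemma rs_eq_trans: "rs_eq Xs Ys F G \<Longrightarrow> rs_eq Xs Ys G H \<Longrightarrow> rs_eq Xs Ys F H"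
  by (simp add: rs_eq_def)

lemma lrs_isomorphism_Spec_map:
  assumes A: "cring A" and B: "cring B" and \<phi>: "\<phi> \<in> ring_iso A B"
  shows "lrs_isomorphism (Spec B) (Spec A) (Spec_map A B \<phi>)"
proof -
  interpret A: cring A by fact
  interpret B: cring B by fact
  define \<psi> where "\<psi> = inv_into (carrier A) \<phi>"
  have bij: "bij_betw \<phi> (carrier A) (carrier B)" using \<phi> by (simp add: ring_iso_def)
  have hom: "\<phi> \<in> ring_hom A B" "\<psi> \<in> ring_hom B A"
    using \<phi> ring_iso_set_sym[OF A.ring_axioms \<phi>] by (auto simp: ring_iso_def \<psi>_def)
  have 1: "(\<psi> \<circ> \<phi>) a = id a" if "a \<in> carrier A" for a
    using that bij bij_betw_inv_into_left unfolding \<psi>_def by fastforce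
  have 2: "(\<phi> \<circ> \<psi>) b = id b" if "b \<in> carrier B" for b
    using that bij bij_betw_inv_into_right unfolding \<psi>_def by fastforce
  have "rs_eq (Spec B) (Spec B) (rs_comp (Spec A) (Spec_map B A \<psi>) (Spec_map A B \<phi>)) rs_id"
    by (rule rs_eq_trans[OF Spec_map_comp[OF B A hom(2,1)]])
      (rule rs_eq_trans[OF Spec_map_cong[OF B ring_hom_trans[OF hom(2,1)] 2] Spec_map_id[OF B]])
  moreover have "rs_eq (Spec A) (Spec A) (rs_comp (Spec B) (Spec_map A B \<phi>) (Spec_map B A \<psi>)) rs_id"
    by (rule rs_eq_trans[OF Spec_map_comp[OF A B hom]])
      (rule rs_eq_trans[OF Spec_map_cong[OF A ring_hom_trans[OF hom] 1] Spec_map_id[OF A]])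
  ultimately show ?thesis
    unfolding lrs_isomorphism_def
    using lrs_morphism_Spec_map[OF A hom(1)] lrs_morphism_Spec_map[OF B hom(2)] by blast
qed

text \<open>
  For a ring isomorphism \<open>\<phi>\<close> that carries \<open>J\<close> onto \<open>I\<close>, the induced map on quotients sends a
  coset to its image as a set.
\<close>

lemma image_coset:
  assumes \<phi>: "\<phi> \<in> ring_hom A B" and J: "J \<subseteq> carrier A" and a: "a \<in> carrier A"
  shows "\<phi> ` (J +>\<^bsub>A\<^esub> a) = (\<phi> ` J) +>\<^bsub>B\<^esub> \<phi> a"
proof -
  have "\<phi> ` (J +>\<^bsub>A\<^esub> a) = (\<Union>h\<in>J. {\<phi> (h \<oplus>\<^bsub>A\<^esub> a)})"
    by (simp add: a_r_coset_def' image_UN)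
  also have "\<dots> = (\<Union>h\<in>J. {\<phi> h \<oplus>\<^bsub>B\<^esub> \<phi> a})"
    using J a by (intro SUP_cong refl) (auto simp: ring_hom_add[OF \<phi>])
  finally show ?thesis by (simp add: a_r_coset_def')
qed

lemma carrier_Quot: "carrier (A Quot J) = ((+>\<^bsub>A\<^esub>) J) ` carrier A"
  by (auto simp: FactRing_def A_RCOSETS_def')

lemma quotient_image_hom:
  assumes "ideal J A" "ideal I B" and \<phi>: "\<phi> \<in> ring_hom A B" and I: "\<phi> ` J = I"
  shows "(`) \<phi> \<in> ring_hom (A Quot J) (B Quot I)"
proof -
  interpret J: ideal J A by fact
  interpret I: ideal I B by fact
  note im = image_coset[OF \<phi> J.a_subset, unfolded I]
  show ?thesis
  proof (rule ring_hom_memI)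
    fix U W assume "U \<in> carrier (A Quot J)" "W \<in> carrier (A Quot J)"
    then obtain a b where C: "a \<in> carrier A" "b \<in> carrier A"
      and UW: "U = J +>\<^bsub>A\<^esub> a" "W = J +>\<^bsub>A\<^esub> b"
      by (auto simp: carrier_Quot)
    have D: "\<phi> a \<in> carrier B" "\<phi> b \<in> carrier B" using C \<phi> by (auto simp: ring_hom_closed)
    note h = ring_hom_mult[OF J.rcos_ring_hom C] ring_hom_add[OF J.rcos_ring_hom C]
      ring_hom_mult[OF I.rcos_ring_hom D] ring_hom_add[OF I.rcos_ring_hom D]
    show "\<phi> ` U \<in> carrier (B Quot I)"
      unfolding UW im[OF C(1)] by (rule ring_hom_closed[OF I.rcos_ring_hom D(1)])
    show "\<phi> ` (U \<otimes>\<^bsub>A Quot J\<^esub> W) = \<phi> ` U \<otimes>\<^bsub>B Quot I\<^esub> \<phi> ` W"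
      unfolding UW h(1)[symmetric] using C by (simp add: im h(3)[symmetric] ring_hom_mult[OF \<phi>])
    show "\<phi> ` (U \<oplus>\<^bsub>A Quot J\<^esub> W) = \<phi> ` U \<oplus>\<^bsub>B Quot I\<^esub> \<phi> ` W"
      unfolding UW h(2)[symmetric] using C by (simp add: im h(4)[symmetric] ring_hom_add[OF \<phi>])
  next
    show "\<phi> ` \<one>\<^bsub>A Quot J\<^esub> = \<one>\<^bsub>B Quot I\<^esub>"
      using im[OF J.one_closed] ring_hom_one[OF \<phi>] ring_hom_one[OF J.rcos_ring_hom]
        ring_hom_one[OF I.rcos_ring_hom] by simp
  qed
qed

theorem closed_subscheme_iso:
  assumes A: "cring A" and B: "cring B" and J: "ideal J A" and I: "ideal I B"
    and \<phi>: "\<phi> \<in> ring_iso A B" and IJ: "\<phi> ` J = I"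
  obtains \<psi> where "lrs_isomorphism (closed_subscheme B I) (closed_subscheme A J) \<psi>"
    "rs_eq (closed_subscheme B I) (Spec A)
      (rs_comp (closed_subscheme A J) (closed_immersion A J) \<psi>)
      (rs_comp (Spec B) (Spec_map A B \<phi>) (closed_immersion B I))"
proof
  interpret A: cring A by fact
  interpret B: cring B by fact
  interpret J: ideal J A by fact
  interpret I: ideal I B by fact
  have QJ: "cring (A Quot J)" and QI: "cring (B Quot I)"
    using J.quotient_is_cring[OF A] I.quotient_is_cring[OF B] by auto
  have bij: "bij_betw \<phi> (carrier A) (carrier B)" and hom: "\<phi> \<in> ring_hom A B"
    using \<phi> by (auto simp: ring_iso_def)
  have inj: "inj_on \<phi> (carrier A)" using bij by (simp add: bij_betw_def)
  have hom': "(`) \<phi> \<in> ring_hom (A Quot J) (B Quot I)"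
    by (rule quotient_image_hom[OF J I hom IJ])
  note im = image_coset[OF hom J.a_subset, unfolded IJ]
  have "U \<subseteq> carrier A" if "U \<in> carrier (A Quot J)" for U
    using that A.a_r_coset_subset_G J.a_subset by (auto simp: carrier_Quot)
  then have "inj_on ((`) \<phi>) (carrier (A Quot J))"
    by (meson inj_onI inj inj_on_image_eq_iff)
  moreover have "(`) \<phi> ` carrier (A Quot J) = carrier (B Quot I)"
  proof -
    have "(`) \<phi> ` carrier (A Quot J) = ((+>\<^bsub>B\<^esub>) I) ` \<phi> ` carrier A"
      unfolding carrier_Quot image_image by (rule image_cong) (simp_all add: im)
    then show ?thesis using bij by (simp add: carrier_Quot bij_betw_def)
  qed
  ultimately have "(`) \<phi> \<in> ring_iso (A Quot J) (B Quot I)"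
    using hom' by (simp add: ring_iso_def bij_betw_def)
  then show "lrs_isomorphism (closed_subscheme B I) (closed_subscheme A J)
      (Spec_map (A Quot J) (B Quot I) ((`) \<phi>))"
    unfolding closed_subscheme_def by (rule lrs_isomorphism_Spec_map[OF QJ QI])
  (* both composites are Spec of the homomorphism that sends a to I + \<phi> a = \<phi> ` (J + a) *)
  have "rs_eq (Spec (B Quot I)) (Spec A)
      (Spec_map A (B Quot I) ((`) \<phi> \<circ> (+>\<^bsub>A\<^esub>) J)) (Spec_map A (B Quot I) ((+>\<^bsub>B\<^esub>) I \<circ> \<phi>))"
    by (rule Spec_map_cong[OF A ring_hom_trans[OF J.rcos_ring_hom hom']]) (simp add: im)
  then show "rs_eq (closed_subscheme B I) (Spec A)
      (rs_comp (closed_subscheme A J) (closed_immersion A J) (Spec_map (A Quot J) (B Quot I) ((`) \<phi>)))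
      (rs_comp (Spec B) (Spec_map A B \<phi>) (closed_immersion B I))"
    unfolding closed_subscheme_def closed_immersion_def
    using Spec_map_comp[OF A QJ J.rcos_ring_hom hom'] Spec_map_comp[OF A B hom I.rcos_ring_hom]
    by (meson rs_eq_sym rs_eq_trans)
qed


section \<open>Principal minors of an inverse matrix\<close>

text \<open>
  If the rows outside \<open>I\<close> are those of the identity matrix, then only permutations that fix all
  indices outside \<open>I\<close> contribute to the determinant.
\<close>

lemma principal_minor_eq_det:
  fixes A :: "'a::comm_ring_1^'n^'n"
  shows "principal_minor A I = det (\<chi> i j. if i \<in> I then A $ i $ j else mat 1 $ i $ j)"
    (is "_ = det ?B")
proof -
  have perm: "p permutes I \<longleftrightarrow> p permutes UNIV \<and> (\<forall>i. i \<notin> I \<longrightarrow> p i = i)" for p :: "'n \<Rightarrow> 'n"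
    by (auto simp: permutes_def)
  have "det ?B = (\<Sum>p | p permutes I. of_int (sign p) * (\<Prod>i\<in>UNIV. ?B $ i $ p i))"
    unfolding det_def
  proof (rule sum.mono_neutral_right)
    show "\<forall>p\<in>{p. p permutes UNIV} - {p. p permutes I}.
        of_int (sign p) * (\<Prod>i\<in>UNIV. ?B $ i $ p i) = 0"
    proof
      fix p assume "p \<in> {p. p permutes (UNIV :: 'n set)} - {p. p permutes I}"
      then obtain i where "i \<notin> I" "p i \<noteq> i" using perm by auto
      then have "?B $ i $ p i = 0" by (simp add: mat_def)
      then have "(\<Prod>i\<in>UNIV. ?B $ i $ p i) = 0" by (intro prod_zero bexI[of _ i]) auto
      then show "of_int (sign p) * (\<Prod>i\<in>UNIV. ?B $ i $ p i) = 0" by simp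
    qed
  qed (auto simp: perm)
  also have "\<dots> = principal_minor A I"
    unfolding principal_minor_def
  proof (intro sum.cong refl arg_cong2[where f = "(*)"])
    fix p assume "p \<in> {p. p permutes I}"
    then have "(\<Prod>i\<in>UNIV. ?B $ i $ p i) = (\<Prod>i\<in>I. ?B $ i $ p i)"
      by (intro prod.mono_neutral_right) (auto simp: perm mat_def)
    then show "(\<Prod>i\<in>UNIV. ?B $ i $ p i) = (\<Prod>i\<in>I. A $ i $ p i)" by simp
  qed
  finally show ?thesis by simp
qed

text \<open>
  A special case of Jacobi's complementary minor formula. It follows from multiplicativity of the
  determinant alone, since multiplication by \<open>B\<close> turns the rows of \<open>A\<close> into rows of the identity and
  conversely.
\<close>

theorem principal_minor_inverse:
  fixes A B :: "'a::comm_ring_1^'n^'n"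
  assumes "A ** B = mat 1"
  shows "principal_minor B (- I) = principal_minor A I * det B"
proof -
  have "(\<chi> i j. if i \<in> I then A $ i $ j else mat 1 $ i $ j) ** B =
      (\<chi> i j. if i \<in> - I then B $ i $ j else mat 1 $ i $ j)"
  proof (simp add: vec_eq_iff, intro allI conjI impI)
    fix i j
    show "((\<chi> i j. if i \<in> I then A $ i $ j else mat 1 $ i $ j) ** B) $ i $ j = mat 1 $ i $ j"
      if "i \<in> I"
      using that unfolding assms[symmetric] by (simp add: matrix_matrix_mult_def)
    have "((\<chi> i j. if i \<in> I then A $ i $ j else mat 1 $ i $ j) ** B) $ i $ j = (mat 1 ** B) $ i $ j"
      if "i \<notin> I"
      using that by (simp add: matrix_matrix_mult_def)
    then show "((\<chi> i j. if i \<in> I then A $ i $ j else mat 1 $ i $ j) ** B) $ i $ j = B $ i $ j"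
      if "i \<notin> I"
      using that by (simp add: matrix_mul_lid)
  qed
  then show ?thesis
    unfolding principal_minor_eq_det det_mul[symmetric] by simp
qed

text \<open>
  The entry of the adjugate in row \<open>k\<close>, column \<open>j\<close> is the determinant of \<open>A\<close> with row \<open>j\<close> replaced by the
  \<open>k\<close>-th unit vector. By linearity in row \<open>j\<close>, the \<open>(i, j)\<close> entry of the product is the determinant
  of \<open>A\<close> with row \<open>j\<close> replaced by row \<open>i\<close>.
\<close>

lemma exists_adjugate:
  fixes A :: "'a::comm_ring_1^'n^'n"
  obtains C where "A ** C = mat (det A)"
proof
  let ?C = "\<chi> k j. det (\<chi> i. if i = j then axis k 1 else A $ i)"
  have "(A ** ?C) $ i $ j = mat (det A) $ i $ j" for i j
  proof -
    have "(A ** ?C) $ i $ j =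
        (\<Sum>k\<in>UNIV. det (\<chi> l. if l = j then A $ i $ k *s axis k 1 else A $ l))"
      by (simp add: matrix_matrix_mult_def det_row_mul[where a = "\<lambda>_. axis _ 1"])
    also have "\<dots> = det (\<chi> l. if l = j then (\<Sum>k\<in>UNIV. A $ i $ k *s axis k 1) else A $ l)"
      by (rule det_linear_row_sum[symmetric]) simp
    also have "(\<Sum>k\<in>UNIV. A $ i $ k *s axis k 1) = A $ i"
      by (simp add: vec_eq_iff axis_def if_distrib cong: if_cong)
    also have "det (\<chi> l. if l = j then A $ i else A $ l) = mat (det A) $ i $ j"
    proof (cases "i = j")
      case True
      then have "(\<chi> l. if l = j then A $ i else A $ l) = A" by (simp add: vec_eq_iff)
      then show ?thesis using True by (simp add: mat_def)
    next
      case False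
      then show ?thesis
        by (simp add: mat_def det_identical_rows[OF False] row_def)
    qed
    finally show ?thesis .
  qed
  then show "A ** ?C = mat (det A)" by (simp add: vec_eq_iff)
qed

lemma matrix_inverse_unique:
  fixes A B C :: "'a::comm_ring_1^'n^'n"
  assumes "B ** A = mat 1" "A ** C = mat 1"
  shows "B = C"
  using assms matrix_mul_assoc[of B A C] by (simp add: matrix_mul_lid matrix_mul_rid)

text \<open>
  The adjugate gives a right inverse; a left inverse is the transpose of a right inverse of the
  transpose, and the two agree.
\<close>

lemma exists_matrix_inverse:
  fixes A :: "'a::comm_ring_1^'n^'n"
  assumes unit: "det A * d = 1"
  obtains B where "A ** B = mat 1" "B ** A = mat 1"
proof -
  have right: "\<exists>B. A ** B = mat 1" if d: "det A * d = 1" for A :: "'a^'n^'n"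
  proof -
    obtain C where C: "A ** C = mat (det A)" by (rule exists_adjugate)
    have "(A ** (\<chi> i j. C $ i $ j * d)) $ i $ j = (A ** C) $ i $ j * d" for i j
      by (simp add: matrix_matrix_mult_def sum_distrib_right mult.assoc)
    then have "A ** (\<chi> i j. C $ i $ j * d) = mat 1"
      using d by (simp add: vec_eq_iff C mat_def)
    then show ?thesis by blast
  qed
  obtain B where B: "A ** B = mat 1" using right[OF unit] by blast
  obtain C where "transpose A ** C = mat 1" using right[of "transpose A"] unit by auto
  then have "transpose (transpose A ** C) = mat 1" by (simp add: transpose_mat)
  then have C: "transpose C ** A = mat 1" by (simp add: matrix_transpose_mul transpose_transpose)
  show thesis using that[OF B] C matrix_inverse_unique[OF C B] by simp
qed

lemma left_inverse_if_right_inverse: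
  fixes A B :: "'a::comm_ring_1^'n^'n"
  assumes AB: "A ** B = mat 1"
  shows "B ** A = mat 1"
proof -
  have "det A * det B = 1" using det_mul[of A B] AB by simp
  then obtain C where C: "C ** A = mat 1" using exists_matrix_inverse by metis
  then show ?thesis using matrix_inverse_unique[OF C AB] by simp
qed


section \<open>Homomorphisms of commutative rings and polynomial evaluation\<close>

lemma ring_of_type_algebra_simps [simp]:
  "carrier ring_of_type_algebra = UNIV"
  "x \<otimes>\<^bsub>ring_of_type_algebra\<^esub> y = x * y"
  "x \<oplus>\<^bsub>ring_of_type_algebra\<^esub> y = x + y"
  "\<one>\<^bsub>ring_of_type_algebra\<^esub> = 1"
  "\<zero>\<^bsub>ring_of_type_algebra\<^esub> = 0"
  by (simp_all add: ring_of_type_algebra_def)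

lemma nat_pow_ring_of_type_algebra [simp]:
  "(x::'a::comm_ring_1) [^]\<^bsub>ring_of_type_algebra\<^esub> (k::nat) = x ^ k"
  by (induction k) (simp_all add: nat_pow_def mult.commute)

lemma finsum_ring_of_type_algebra:
  fixes f :: "'b \<Rightarrow> 'a::comm_ring_1"
  assumes "finite A"
  shows "(\<Oplus>\<^bsub>ring_of_type_algebra\<^esub>a\<in>A. f a) = (\<Sum>a\<in>A. f a)"
proof -
  interpret cring "ring_of_type_algebra :: 'a ring" by (rule cring_from_type_algebra)
  show ?thesis using assms by (induction rule: finite_induct) simp_all
qed

locale comm_ring_hom =
  fixes f :: "'a::comm_ring_1 \<Rightarrow> 'b::comm_ring_1"
  assumes add: "f (x + y) = f x + f y"
    and mult: "f (x * y) = f x * f y"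
    and one: "f 1 = 1"
begin

lemma zero: "f 0 = 0"
  using add[of 0 0] by simp

lemma minus: "f (- x) = - f x"
  using add[of x "- x"] zero by (simp add: eq_neg_iff_add_eq_0 add.commute)

lemma sum: "f (\<Sum>a\<in>A. g a) = (\<Sum>a\<in>A. f (g a))"
  by (induction A rule: infinite_finite_induct) (simp_all add: zero add)

lemma prod: "f (\<Prod>a\<in>A. g a) = (\<Prod>a\<in>A. f (g a))"
  by (induction A rule: infinite_finite_induct) (simp_all add: one mult)

lemma power: "f (x ^ k) = f x ^ k"
  by (induction k) (simp_all add: one mult)

lemma principal_minor:
  "f (principal_minor A I) = principal_minor (\<chi> i j. f (A $ i $ j)) I"
proof -
  have "f (of_int (sign p) * x) = of_int (sign p) * f x" for p :: "'c \<Rightarrow> 'c" and x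
    by (cases p rule: sign_cases) (simp_all add: minus)
  then show ?thesis by (simp add: principal_minor_def sum prod)
qed

lemma matrix_mult_one:
  assumes "A ** B = mat 1"
  shows "(\<chi> i j. f (A $ i $ j)) ** (\<chi> i j. f (B $ i $ j)) = mat 1"
proof -
  have "((\<chi> i j. f (A $ i $ j)) ** (\<chi> i j. f (B $ i $ j))) $ i $ j = f ((A ** B) $ i $ j)" for i j
    by (simp add: matrix_matrix_mult_def sum mult)
  then show ?thesis
    unfolding assms by (simp add: vec_eq_iff mat_def one zero)
qed

end

lemma comm_ring_hom_iff:
  "comm_ring_hom f \<longleftrightarrow> f \<in> ring_hom ring_of_type_algebra ring_of_type_algebra"
  by (auto simp: comm_ring_hom_def ring_hom_def)

lemma poly_mapping_add_induct [case_names zero single add]: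
  fixes f :: "'a \<Rightarrow>\<^sub>0 'b::comm_monoid_add"
  assumes "P 0" "\<And>a b. P (Poly_Mapping.single a b)" "\<And>f g. P f \<Longrightarrow> P g \<Longrightarrow> P (f + g)"
  shows "P f"
proof (induction f rule: update_induct)
  case (update f a b)
  have "Poly_Mapping.update a b f = f + Poly_Mapping.single a b"
    using update(1)
    by (intro poly_mapping_eqI) (auto simp: lookup_update lookup_add lookup_single in_keys_iff)
  then show ?case using assms update by simp
qed (rule assms(1))

definition mpoly_eval ::
  "('k::comm_ring_1 \<Rightarrow> 'a::comm_ring_1) \<Rightarrow> ('v::finite \<Rightarrow> 'a) \<Rightarrow> (('v \<Rightarrow>\<^sub>0 nat) \<Rightarrow>\<^sub>0 'k) \<Rightarrow> 'a" where
  "mpoly_eval h x p =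
     (\<Sum>m\<in>Poly_Mapping.keys p. h (Poly_Mapping.lookup p m) * (\<Prod>v\<in>UNIV. x v ^ Poly_Mapping.lookup m v))"

context comm_ring_hom
begin

lemma mpoly_eval_superset:
  assumes "finite F" "Poly_Mapping.keys p \<subseteq> F"
  shows "mpoly_eval f x p =
    (\<Sum>m\<in>F. f (Poly_Mapping.lookup p m) * (\<Prod>v\<in>UNIV. x v ^ Poly_Mapping.lookup m v))"
  unfolding mpoly_eval_def using assms
  by (intro sum.mono_neutral_left) (auto simp: in_keys_iff zero)

lemma mpoly_eval_add: "mpoly_eval f x (p + q) = mpoly_eval f x p + mpoly_eval f x q"
proof -
  let ?F = "Poly_Mapping.keys p \<union> Poly_Mapping.keys q"
  have "Poly_Mapping.keys (p + q) \<subseteq> ?F" by (rule keys_add)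
  then show ?thesis
    by (simp add: mpoly_eval_superset[of ?F] lookup_add add distrib_right sum.distrib)
qed

lemma mpoly_eval_single:
  "mpoly_eval f x (Poly_Mapping.single m c) = f c * (\<Prod>v\<in>UNIV. x v ^ Poly_Mapping.lookup m v)"
  by (simp add: mpoly_eval_superset[of "{m}"])

lemma mpoly_eval_mult: "mpoly_eval f x (p * q) = mpoly_eval f x p * mpoly_eval f x q"
proof (induction p rule: poly_mapping_add_induct)
  case (single m c)
  show ?case
  proof (induction q rule: poly_mapping_add_induct)
    case (single n d)
    show ?case
      by (simp add: mult_single mpoly_eval_single mult lookup_add power_add prod.distrib mult_ac)
  qed (simp_all add: mpoly_eval_add distrib_left, simp add: mpoly_eval_def)
qed (simp_all add: mpoly_eval_add distrib_right, simp add: mpoly_eval_def)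

theorem mpoly_eval_hom: "comm_ring_hom (mpoly_eval f x)"
proof
  show "mpoly_eval f x 1 = 1"
    using mpoly_eval_single[of x 0 1] by (simp add: one)
qed (rule mpoly_eval_add mpoly_eval_mult)+

lemma mpoly_eval_const: "mpoly_eval f x (Poly_Mapping.single 0 c) = f c"
  by (simp add: mpoly_eval_single)

lemma mpoly_eval_var: "mpoly_eval f x (Poly_Mapping.single (Poly_Mapping.single v 1) 1) = x v"
proof -
  have "(\<Prod>w\<in>UNIV. x w ^ (if v = w then Suc 0 else 0)) = x v"
    by (simp add: if_distrib[where f = "(^) _"] cong: if_cong)
  then show ?thesis
    by (simp add: mpoly_eval_single one lookup_single when_def)
qed

end

text \<open>
  The polynomials at which two homomorphisms agree are closed under sums and products, and every
  polynomial is built from constants and variables in this way.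
\<close>

lemma mpoly_hom_eqI:
  fixes f g :: "(('v \<Rightarrow>\<^sub>0 nat) \<Rightarrow>\<^sub>0 'k::comm_ring_1) \<Rightarrow> 'b" and T :: "('b, 'm) ring_scheme"
  assumes "f \<in> ring_hom ring_of_type_algebra T" "g \<in> ring_hom ring_of_type_algebra T" "cring T"
    and const: "\<And>c. f (Poly_Mapping.single 0 c) = g (Poly_Mapping.single 0 c)"
    and var: "\<And>v. f (Poly_Mapping.single (Poly_Mapping.single v 1) 1) =
      g (Poly_Mapping.single (Poly_Mapping.single v 1) 1)"
  shows "f p = g p"
proof -
  interpret S: cring "ring_of_type_algebra :: (('v \<Rightarrow>\<^sub>0 nat) \<Rightarrow>\<^sub>0 'k) ring"
    by (rule cring_from_type_algebra)
  interpret f: ring_hom_cring ring_of_type_algebra T f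
    by (intro ring_hom_cring.intro ring_hom_cring_axioms.intro assms S.cring_axioms)
  interpret g: ring_hom_cring ring_of_type_algebra T g
    by (intro ring_hom_cring.intro ring_hom_cring_axioms.intro assms S.cring_axioms)
  have add: "f (p + q) = g (p + q)" if "f p = g p" "f q = g q" for p q
    using that f.hom_add[of p q] g.hom_add[of p q] by simp
  have mult: "f (p * q) = g (p * q)" if "f p = g p" "f q = g q" for p q
    using that f.hom_mult[of p q] g.hom_mult[of p q] by simp
  have one: "f 1 = g 1" using f.hom_one g.hom_one by simp
  have pow: "f (Poly_Mapping.single (Poly_Mapping.single v k) 1) =
      g (Poly_Mapping.single (Poly_Mapping.single v k) 1)" for v k
  proof (induction k)
    case (Suc k)
    have "Poly_Mapping.single (Poly_Mapping.single v (Suc k)) (1::'k) =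
        Poly_Mapping.single (Poly_Mapping.single v k) 1 * Poly_Mapping.single (Poly_Mapping.single v 1) 1"
      by (simp add: mult_single single_add[symmetric])
    then show ?case using mult[OF Suc var] by simp
  qed (simp add: one)
  have mon: "f (Poly_Mapping.single m 1) = g (Poly_Mapping.single m 1)" for m
  proof (induction m rule: poly_mapping_add_induct)
    case (add m n)
    have "Poly_Mapping.single (m + n) (1::'k) = Poly_Mapping.single m 1 * Poly_Mapping.single n 1"
      by (simp add: mult_single)
    then show ?case using mult add by simp
  qed (simp_all add: one pow)
  show ?thesis
  proof (induction p rule: poly_mapping_add_induct)
    case (single m c)
    have "Poly_Mapping.single m c = Poly_Mapping.single 0 c * Poly_Mapping.single m 1"
      by (simp add: mult_single)
    then show ?case using mult[OF const mon] by simp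
  qed (simp_all add: add f.hom_zero[simplified] g.hom_zero[simplified])
qed


section \<open>The coordinate ring of the general linear group\<close>

lemma multiplicative_subset_det_powers:
  "multiplicative_subset S_ring (powers S_ring (det gen_mat :: ('k::comm_ring_1, 'n::finite) mpoly))"
  by (rule multiplicative_subset_powers) (simp_all add: cring_from_type_algebra)

interpretation S\<Delta>: multiplicative_subset
    "S_ring :: ('k::comm_ring_1, 'n::finite) mpoly ring"
    "powers S_ring (det gen_mat :: ('k::comm_ring_1, 'n::finite) mpoly)"
  rewrites "localization S_ring (powers S_ring (det gen_mat :: ('k, 'n) mpoly)) = S\<Delta>_ring"
  by (rule multiplicative_subset_det_powers) (simp add: S\<Delta>_ring_def)

lemma cring_S\<Delta>: "cring (S\<Delta>_ring :: ('k::comm_ring_1, 'n::finite) S\<Delta> ring)"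
  by (rule S\<Delta>.cring_localization)

lemma to_S\<Delta>_hom: "to_S\<Delta> \<in> ring_hom (S_ring :: ('k::comm_ring_1, 'n::finite) mpoly ring) S\<Delta>_ring"
  using S\<Delta>.fraction_hom by (simp add: to_S\<Delta>_def[abs_def])

text \<open>
  Evaluation of the variables at the identity matrix sends \<open>\<Delta>\<close> to \<open>1\<close>, so \<open>\<Delta>\<close> is not nilpotent and \<open>S\<^sub>\<Delta>\<close>
  is not the zero ring; a type of class \<open>comm_ring_1\<close> must satisfy \<open>0 \<noteq> 1\<close>.
\<close>

lemma det_gen_mat_power_nonzero: "det (gen_mat :: ('k::comm_ring_1, 'n::finite) mpoly ^ 'n ^ 'n) ^ k \<noteq> 0"
proof
  assume eq: "det (gen_mat :: ('k, 'n) mpoly ^ 'n ^ 'n) ^ k = 0"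
  interpret h: comm_ring_hom "id :: 'k \<Rightarrow> 'k" by standard simp_all
  define e :: "('k, 'n) mpoly \<Rightarrow> 'k" where "e = mpoly_eval id (\<lambda>(i, j). mat 1 $ i $ j)"
  interpret e: comm_ring_hom e unfolding e_def by (rule h.mpoly_eval_hom)
  have "e (gen_mat $ i $ j) = mat 1 $ i $ j" for i j
    using h.mpoly_eval_var[of "\<lambda>(i, j). mat 1 $ i $ j" "(i, j)"] by (simp add: gen_mat_def e_def)
  then have "(\<chi> i j. e (gen_mat $ i $ j)) = mat 1" by (simp add: vec_eq_iff)
  then have "e (det gen_mat) = 1"
    using e.principal_minor[of gen_mat UNIV] by (simp add: principal_minor_UNIV)
  then have "e (det gen_mat ^ k) = 1" by (simp add: e.power)
  then show False using eq by (simp add: e.zero)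
qed

lemma S\<Delta>_one_neq_zero: "\<one>\<^bsub>S\<Delta>_ring\<^esub> \<noteq> \<zero>\<^bsub>S\<Delta>_ring :: ('k::comm_ring_1, 'n::finite) S\<Delta> ring\<^esub>"
proof
  assume "\<one>\<^bsub>S\<Delta>_ring\<^esub> = \<zero>\<^bsub>S\<Delta>_ring :: ('k, 'n) S\<Delta> ring\<^esub>"
  then obtain u where "u \<in> powers S_ring (det gen_mat :: ('k, 'n) mpoly)" "u = 0"
    unfolding S\<Delta>.one_localization S\<Delta>.zero_localization
    using S\<Delta>.fraction_eq_iff[OF _ _ S\<Delta>.one_mem S\<Delta>.one_mem, of 1 "0 :: ('k, 'n) mpoly"] by auto
  then show False using det_gen_mat_power_nonzero by (auto simp: powers_def)
qed

text \<open>
  A copy of \<open>S\<^sub>\<Delta>\<close> as a type, to make matrices over \<open>S\<^sub>\<Delta>\<close> and their determinants available.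
\<close>

typedef (overloaded) ('k, 'n) gl_ring = "carrier (S\<Delta>_ring :: ('k::comm_ring_1, 'n::finite) S\<Delta> ring)"
  morphisms rep_gl abs_gl
  using S\<Delta>.fraction_closed[OF _ S\<Delta>.one_mem, of 1] by auto

instantiation gl_ring :: (comm_ring_1, finite) comm_ring_1
begin

definition "0 = abs_gl \<zero>\<^bsub>S\<Delta>_ring\<^esub>"
definition "1 = abs_gl \<one>\<^bsub>S\<Delta>_ring\<^esub>"
definition "x + y = abs_gl (rep_gl x \<oplus>\<^bsub>S\<Delta>_ring\<^esub> rep_gl y)"
definition "x * y = abs_gl (rep_gl x \<otimes>\<^bsub>S\<Delta>_ring\<^esub> rep_gl y)"
definition "- x = abs_gl (\<ominus>\<^bsub>S\<Delta>_ring\<^esub> rep_gl x)"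
definition "x - y = abs_gl (rep_gl x \<ominus>\<^bsub>S\<Delta>_ring\<^esub> rep_gl y)"

instance
proof -
  interpret R: cring "S\<Delta>_ring :: ('a, 'b) S\<Delta> ring" by (rule cring_S\<Delta>)
  note [simp] = rep_gl abs_gl_inverse rep_gl_inject[symmetric] zero_gl_ring_def one_gl_ring_def
    plus_gl_ring_def times_gl_ring_def uminus_gl_ring_def minus_gl_ring_def
  show "OFCLASS(('a, 'b) gl_ring, comm_ring_1_class)"
  proof
    fix a b c :: "('a, 'b) gl_ring"
    show "a * b * c = a * (b * c)" "a * b = b * a" "1 * a = a"
      by (simp_all add: R.m_ac)
    show "a + b + c = a + (b + c)" "a + b = b + a" "0 + a = a"
      by (simp_all add: R.a_ac)
    show "- a + a = 0" "a - b = a + - b" "(a + b) * c = a * c + b * c"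
      by (simp_all add: R.l_neg R.minus_eq R.l_distr)
    show "0 \<noteq> (1 :: ('a, 'b) gl_ring)"
      using S\<Delta>_one_neq_zero by (simp add: eq_commute)
  qed
qed

end

lemma rep_gl_hom: "rep_gl \<in> ring_hom ring_of_type_algebra S\<Delta>_ring"
proof -
  interpret R: cring "S\<Delta>_ring :: ('a::comm_ring_1, 'b::finite) S\<Delta> ring" by (rule cring_S\<Delta>)
  show "(rep_gl :: ('a, 'b) gl_ring \<Rightarrow> _) \<in> ring_hom ring_of_type_algebra S\<Delta>_ring"
    by (rule ring_hom_memI)
      (simp_all add: rep_gl abs_gl_inverse one_gl_ring_def plus_gl_ring_def times_gl_ring_def)
qed

lemma abs_gl_hom: "abs_gl \<in> ring_hom S\<Delta>_ring ring_of_type_algebra"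
  by (rule ring_hom_memI)
    (simp_all add: abs_gl_inverse one_gl_ring_def plus_gl_ring_def times_gl_ring_def)

lemma comm_ring_hom_abs_gl:
  assumes "h \<in> ring_hom ring_of_type_algebra S\<Delta>_ring"
  shows "comm_ring_hom (\<lambda>x. abs_gl (h x))"
  using ring_hom_trans[OF assms abs_gl_hom] by (simp add: comm_ring_hom_iff comp_def)

lemma rep_gl_one: "rep_gl 1 = \<one>\<^bsub>S\<Delta>_ring\<^esub>"
  using ring_hom_one[OF rep_gl_hom] by simp

lemma rep_gl_zero: "rep_gl (0 :: ('k::comm_ring_1, 'n::finite) gl_ring) = \<zero>\<^bsub>S\<Delta>_ring\<^esub>"
proof -
  interpret R: cring "S\<Delta>_ring :: ('k, 'n) S\<Delta> ring" by (rule cring_S\<Delta>)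
  show ?thesis by (simp add: zero_gl_ring_def abs_gl_inverse)
qed

lemma rep_gl_mult: "rep_gl (x * y) = rep_gl x \<otimes>\<^bsub>S\<Delta>_ring\<^esub> rep_gl y"
  using ring_hom_mult[OF rep_gl_hom, of x y] by simp

lemma rep_gl_sum:
  fixes g :: "'i \<Rightarrow> ('k::comm_ring_1, 'n::finite) gl_ring"
  assumes "finite A"
  shows "rep_gl (\<Sum>a\<in>A. g a) = (\<Oplus>\<^bsub>S\<Delta>_ring\<^esub>a\<in>A. rep_gl (g a))"
proof -
  interpret ring_hom_cring ring_of_type_algebra "S\<Delta>_ring :: ('k, 'n) S\<Delta> ring" rep_gl
    by (intro ring_hom_cring.intro ring_hom_cring_axioms.intro rep_gl_hom cring_S\<Delta> cring_from_type_algebra)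
  show ?thesis
    using hom_finsum[of g A] finsum_ring_of_type_algebra[OF assms, of g] by (simp add: comp_def)
qed

lemma matrix_inverse_in_rep_gl:
  fixes A B :: "('k::comm_ring_1, 'n::finite) gl_ring ^ 'n ^ 'n"
  shows "matrix_inverse_in S\<Delta>_ring (\<lambda>i j. rep_gl (A $ i $ j)) (\<lambda>i j. rep_gl (B $ i $ j)) \<longleftrightarrow>
    A ** B = mat 1 \<and> B ** A = mat 1"
proof -
  have "(\<Oplus>\<^bsub>S\<Delta>_ring\<^esub>k\<in>UNIV. rep_gl (A $ i $ k) \<otimes>\<^bsub>S\<Delta>_ring\<^esub> rep_gl (B $ k $ j)) =
      (if i = j then \<one>\<^bsub>S\<Delta>_ring\<^esub> else \<zero>\<^bsub>S\<Delta>_ring\<^esub>) \<longleftrightarrow> (A ** B) $ i $ j = mat 1 $ i $ j"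
    for A B :: "('k, 'n) gl_ring ^ 'n ^ 'n" and i j
    by (simp add: rep_gl_inject matrix_matrix_mult_def mat_def
        flip: rep_gl_mult rep_gl_sum rep_gl_one rep_gl_zero)
  then show ?thesis
    unfolding matrix_inverse_in_def by (auto simp: rep_gl vec_eq_iff)
qed

abbreviation gl_mat :: "('k::comm_ring_1, 'n::finite) gl_ring ^ 'n ^ 'n" where
  "gl_mat \<equiv> \<chi> i j. abs_gl (to_S\<Delta> (gen_mat $ i $ j))"

lemma to_S\<Delta>_closed [simp]: "to_S\<Delta> a \<in> carrier S\<Delta>_ring"
  using ring_hom_closed[OF to_S\<Delta>_hom, of a] by simp

lemma rep_abs_to_S\<Delta> [simp]: "rep_gl (abs_gl (to_S\<Delta> a)) = to_S\<Delta> a"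
  by (simp add: abs_gl_inverse)

text \<open>A right inverse of a square matrix is a left inverse, so one of the two products suffices.\<close>

lemma inversion_automorphism_iff:
  "inversion_automorphism \<phi> \<longleftrightarrow> K_algebra_automorphism \<phi> \<and>
    gl_mat ** (\<chi> i j. abs_gl (\<phi> (to_S\<Delta> (gen_mat $ i $ j)))) = mat 1"
    (is "_ \<longleftrightarrow> _ \<and> _ ** ?B = _")
proof (cases "K_algebra_automorphism \<phi>")
  case True
  then have "\<phi> (to_S\<Delta> a) \<in> carrier S\<Delta>_ring" for a
    using ring_hom_closed[of \<phi> S\<Delta>_ring S\<Delta>_ring "to_S\<Delta> a"]
    by (simp add: K_algebra_automorphism_def ring_iso_def)
  then have "matrix_inverse_in S\<Delta>_ring (\<lambda>i j. to_S\<Delta> (gen_mat $ i $ j)) (\<lambda>i j. \<phi> (to_S\<Delta> (gen_mat $ i $ j)))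
      \<longleftrightarrow> gl_mat ** ?B = mat 1 \<and> ?B ** gl_mat = mat 1"
    using matrix_inverse_in_rep_gl[of gl_mat ?B] by (simp add: abs_gl_inverse)
  then show ?thesis
    using True left_inverse_if_right_inverse[of gl_mat ?B] by (auto simp: inversion_automorphism_def)
qed (simp add: inversion_automorphism_def)


section \<open>The inversion automorphism and the principal minor ideals\<close>

text \<open>
  The generic matrix \<open>A\<close> is invertible over \<open>S\<^sub>\<Delta>\<close> because its determinant is. Evaluation at the inverse
  \<open>B\<close> maps \<open>\<Delta>\<close> to the unit \<open>det B\<close> and so extends to an endomorphism \<open>\<Phi>\<close> of \<open>S\<^sub>\<Delta>\<close> with \<open>\<Phi>(A) = B\<close>. Applying
  \<open>\<Phi>\<close> to \<open>A B = 1\<close> yields \<open>B \<Phi>(B) = 1\<close>, thus \<open>\<Phi>(B) = A\<close>. So \<open>\<Phi> \<circ> \<Phi>\<close> is the identity on constants and on the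
  entries of \<open>A\<close>, hence everywhere, and \<open>\<Phi>\<close> is bijective.
\<close>

lemma exists_inversion_automorphism:
  "\<exists>\<phi> :: ('k::comm_ring_1, 'n::finite) S\<Delta> \<Rightarrow> ('k, 'n) S\<Delta>. inversion_automorphism \<phi>"
proof -
  let ?\<Delta> = "det gen_mat :: ('k, 'n) mpoly"
  let ?A = "gl_mat :: ('k, 'n) gl_ring ^ 'n ^ 'n"
  define \<alpha> :: "('k, 'n) mpoly \<Rightarrow> ('k, 'n) gl_ring" where "\<alpha> a = abs_gl (to_S\<Delta> a)" for a
  interpret R: cring "S\<Delta>_ring :: ('k, 'n) S\<Delta> ring" by (rule cring_S\<Delta>)
  interpret \<alpha>: comm_ring_hom \<alpha>
    unfolding \<alpha>_def by (rule comm_ring_hom_abs_gl[OF to_S\<Delta>_hom])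
  have rep_\<alpha>: "rep_gl (\<alpha> a) = to_S\<Delta> a" for a by (simp add: \<alpha>_def)
  have \<Delta>: "?\<Delta> \<in> powers S_ring ?\<Delta>" by (auto simp: powers_def intro: exI[of _ "1::nat"])
  have det_A: "det ?A = \<alpha> ?\<Delta>"
    using \<alpha>.principal_minor[of gen_mat UNIV] by (simp add: principal_minor_UNIV \<alpha>_def)
  define d where "d = fraction S_ring (powers S_ring ?\<Delta>) 1 ?\<Delta>"
  have d: "d \<in> carrier S\<Delta>_ring" using S\<Delta>.fraction_closed[OF _ \<Delta>, of 1] by (simp add: d_def)
  have "d \<otimes>\<^bsub>S\<Delta>_ring\<^esub> to_S\<Delta> ?\<Delta> = \<one>\<^bsub>S\<Delta>_ring\<^esub>"
    using S\<Delta>.denominator_inverse[OF \<Delta>] by (simp add: to_S\<Delta>_def d_def)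
  then have "rep_gl (det ?A * abs_gl d) = rep_gl 1"
    using d by (simp add: det_A rep_gl_mult rep_gl_one rep_\<alpha> abs_gl_inverse R.m_comm)
  then have unit: "det ?A * abs_gl d = 1" by (simp add: rep_gl_inject)
  obtain B where AB: "?A ** B = mat 1" and BA: "B ** ?A = mat 1"
    using exists_matrix_inverse[OF unit] .
  define \<kappa> where "\<kappa> c = \<alpha> (const c)" for c
  interpret \<kappa>: comm_ring_hom \<kappa>
    by standard (simp_all add: \<kappa>_def const_def single_add \<alpha>.add \<alpha>.mult[symmetric] mult_single \<alpha>.one)
  define e :: "('k, 'n) mpoly \<Rightarrow> ('k, 'n) gl_ring" where "e = mpoly_eval \<kappa> (\<lambda>(i, j). B $ i $ j)"
  interpret e: comm_ring_hom e unfolding e_def by (rule \<kappa>.mpoly_eval_hom)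
  have e_const: "rep_gl (e (const a)) = to_S\<Delta> (const a)" for a
    by (simp add: e_def const_def \<kappa>.mpoly_eval_const) (simp add: \<kappa>_def const_def rep_\<alpha>)
  have e_var: "e (gen_mat $ i $ j) = B $ i $ j" for i j
    using \<kappa>.mpoly_eval_var[of "\<lambda>(i, j). B $ i $ j" "(i, j)"] by (simp add: gen_mat_def e_def)
  have h: "rep_gl \<circ> e \<in> ring_hom S_ring S\<Delta>_ring"
    using ring_hom_trans[OF _ rep_gl_hom] e.comm_ring_hom_axioms by (simp add: comm_ring_hom_iff)
  have "e ?\<Delta> = det B"
    using e.principal_minor[of gen_mat UNIV] e_var by (simp add: principal_minor_UNIV)
  then have "e ?\<Delta> * det ?A = 1"
    using det_mul[of B ?A] by (simp add: BA)
  then have inv: "e (?\<Delta> ^ k) * det ?A ^ k = 1" for k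
    by (simp add: e.power flip: power_mult_distrib)
  have "(rep_gl \<circ> e) ` powers S_ring ?\<Delta> \<subseteq> Units S\<Delta>_ring"
  proof
    fix x assume "x \<in> (rep_gl \<circ> e) ` powers S_ring ?\<Delta>"
    then obtain k where x: "x = rep_gl (e (?\<Delta> ^ k))" by (auto simp: powers_def)
    have "x \<otimes>\<^bsub>S\<Delta>_ring\<^esub> rep_gl (det ?A ^ k) = \<one>\<^bsub>S\<Delta>_ring\<^esub>"
      by (simp add: x inv flip: rep_gl_mult rep_gl_one)
    then show "x \<in> Units S\<Delta>_ring"
      using R.m_comm[of x "rep_gl (det ?A ^ k)"] unfolding Units_def by (auto simp: x rep_gl)
  qed
  then obtain \<Phi> where \<Phi>: "\<Phi> \<in> ring_hom S\<Delta>_ring S\<Delta>_ring" and \<Phi>_to: "\<And>a. \<Phi> (to_S\<Delta> a) = rep_gl (e a)"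
    using S\<Delta>.extend_to_localization[OF cring_S\<Delta> h] by (auto simp: to_S\<Delta>_def)
  have \<Phi>_B: "\<Phi> (rep_gl (B $ i $ j)) = to_S\<Delta> (gen_mat $ i $ j)" for i j
  proof -
    define f where "f x = abs_gl (\<Phi> (rep_gl x))" for x
    interpret f: comm_ring_hom f
      using comm_ring_hom_abs_gl[OF ring_hom_trans[OF rep_gl_hom \<Phi>]] by (simp add: f_def[abs_def] comp_def)
    have "(\<chi> i j. f (?A $ i $ j)) = B"
      by (simp add: f_def \<Phi>_to e_var rep_gl_inverse vec_eq_iff)
    then have "B ** (\<chi> i j. f (B $ i $ j)) = mat 1"
      using f.matrix_mult_one[OF AB] by simp
    then have "(\<chi> i j. f (B $ i $ j)) = ?A"
      using matrix_inverse_unique[OF AB] by simp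
    then have "rep_gl (f (B $ i $ j)) = rep_gl (?A $ i $ j)" by (simp add: vec_eq_iff)
    then show ?thesis
      using ring_hom_closed[OF \<Phi> rep_gl] by (simp add: f_def abs_gl_inverse)
  qed
  have \<Phi>\<Phi>: "(\<Phi> \<circ> \<Phi>) x = id x" if "x \<in> carrier S\<Delta>_ring" for x
  proof (rule S\<Delta>.hom_localization_eqI[OF cring_S\<Delta> ring_hom_trans[OF \<Phi> \<Phi>] _ _ that])
    fix a :: "('k, 'n) mpoly"
    have "((\<Phi> \<circ> \<Phi>) \<circ> to_S\<Delta>) a = to_S\<Delta> a"
    proof (rule mpoly_hom_eqI[OF ring_hom_trans[OF to_S\<Delta>_hom ring_hom_trans[OF \<Phi> \<Phi>]] to_S\<Delta>_hom cring_S\<Delta>])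
      fix c :: 'k
      show "((\<Phi> \<circ> \<Phi>) \<circ> to_S\<Delta>) (Poly_Mapping.single 0 c) =
          (to_S\<Delta> (Poly_Mapping.single 0 c) :: ('k, 'n) S\<Delta>)"
        using e_const[of c] \<Phi>_to[of "const c"] by (simp add: const_def)
    next
      fix v :: "'n \<times> 'n"
      show "((\<Phi> \<circ> \<Phi>) \<circ> to_S\<Delta>) (Poly_Mapping.single (Poly_Mapping.single v 1) (1 :: 'k)) =
          to_S\<Delta> (Poly_Mapping.single (Poly_Mapping.single v 1) 1)"
        using e_var[of "fst v" "snd v"] \<Phi>_to[of "gen_mat $ fst v $ snd v"] \<Phi>_B[of "fst v" "snd v"]
        by (simp add: gen_mat_def)
    qed
    then show "(\<Phi> \<circ> \<Phi>) (fraction S_ring (powers S_ring ?\<Delta>) a \<one>\<^bsub>S_ring\<^esub>) =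
        id (fraction S_ring (powers S_ring ?\<Delta>) a \<one>\<^bsub>S_ring\<^esub>)"
      by (simp add: to_S\<Delta>_def)
  qed (auto intro: ring_hom_memI)
  have "bij_betw \<Phi> (carrier S\<Delta>_ring) (carrier S\<Delta>_ring)"
    by (rule bij_betw_byWitness[where f' = \<Phi>]) (use \<Phi>\<Phi> ring_hom_closed[OF \<Phi>] in auto)
  then have "K_algebra_automorphism \<Phi>"
    using \<Phi> \<Phi>_to e_const by (simp add: K_algebra_automorphism_def ring_iso_def)
  then have "inversion_automorphism \<Phi>"
    using AB by (simp add: inversion_automorphism_iff \<Phi>_to e_var rep_gl_inverse)
  then show ?thesis by blast
qed

text \<open>
  If \<open>\<psi>\<close> is the inverse of \<open>\<phi>\<close>, applying \<open>\<psi>\<close> to \<open>X \<phi>(X) = 1\<close> gives \<open>\<psi>(X) X = 1\<close>. This symmetry turns an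
  inclusion between the ideals of principal minors into an equality.
\<close>

lemma inversion_automorphism_inv:
  fixes \<phi> :: "('k::comm_ring_1, 'n::finite) S\<Delta> \<Rightarrow> ('k, 'n) S\<Delta>"
  assumes "inversion_automorphism \<phi>"
  shows "inversion_automorphism (inv_into (carrier S\<Delta>_ring) \<phi>)"
proof -
  interpret R: cring "S\<Delta>_ring :: ('k, 'n) S\<Delta> ring" by (rule cring_S\<Delta>)
  let ?\<psi> = "inv_into (carrier S\<Delta>_ring) \<phi>"
  define f where "f x = abs_gl (?\<psi> (rep_gl x))" for x
  let ?B = "\<chi> i j. abs_gl (\<phi> (to_S\<Delta> (gen_mat $ i $ j)))"
  have \<phi>: "\<phi> \<in> ring_iso S\<Delta>_ring S\<Delta>_ring" and const: "\<And>c. \<phi> (to_S\<Delta> (const c)) = to_S\<Delta> (const c)"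
    and AB: "gl_mat ** ?B = mat 1"
    using assms by (simp_all add: inversion_automorphism_iff K_algebra_automorphism_def)
  have \<psi>: "?\<psi> \<in> ring_iso S\<Delta>_ring S\<Delta>_ring" by (rule ring_iso_set_sym[OF R.ring_axioms \<phi>])
  have inv: "?\<psi> (\<phi> x) = x" if "x \<in> carrier S\<Delta>_ring" for x
    using that \<phi> by (intro inv_into_f_f) (auto simp: ring_iso_def bij_betw_def)
  have "?\<psi> \<in> ring_hom S\<Delta>_ring S\<Delta>_ring" using \<psi> by (simp add: ring_iso_def)
  then interpret f: comm_ring_hom f
    using comm_ring_hom_abs_gl[OF ring_hom_trans[OF rep_gl_hom]] by (simp add: f_def[abs_def] comp_def)
  have "\<phi> (to_S\<Delta> a) \<in> carrier S\<Delta>_ring" for a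
    using \<phi> ring_hom_closed[of \<phi> S\<Delta>_ring S\<Delta>_ring "to_S\<Delta> a"] by (simp add: ring_iso_def)
  then have "(\<chi> i j. f (?B $ i $ j)) = gl_mat"
    by (simp add: vec_eq_iff abs_gl_inverse inv f_def)
  then have "(\<chi> i j. abs_gl (?\<psi> (to_S\<Delta> (gen_mat $ i $ j)))) ** gl_mat = mat 1"
    using f.matrix_mult_one[OF AB] by (simp add: f_def)
  then have "gl_mat ** (\<chi> i j. abs_gl (?\<psi> (to_S\<Delta> (gen_mat $ i $ j)))) = mat 1"
    by (rule left_inverse_if_right_inverse)
  moreover have "?\<psi> (to_S\<Delta> (const c)) = to_S\<Delta> (const c)" for c
    using inv[of "to_S\<Delta> (const c)"] by (simp add: const)
  ultimately show ?thesis
    using \<psi> by (simp add: inversion_automorphism_iff K_algebra_automorphism_def)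
qed

lemma inversion_automorphism_principal_minor:
  fixes \<phi> :: "('k::comm_ring_1, 'n::finite) S\<Delta> \<Rightarrow> ('k, 'n) S\<Delta>"
  assumes "inversion_automorphism \<phi>"
  obtains d where "d \<in> carrier S\<Delta>_ring"
    "\<phi> (to_S\<Delta> (principal_minor gen_mat I)) = to_S\<Delta> (principal_minor gen_mat (- I)) \<otimes>\<^bsub>S\<Delta>_ring\<^esub> d"
proof
  let ?B = "\<chi> i j. abs_gl (\<phi> (to_S\<Delta> (gen_mat $ i $ j)))"
  have \<phi>: "\<phi> \<in> ring_hom S\<Delta>_ring S\<Delta>_ring" and AB: "gl_mat ** ?B = mat 1"
    using assms by (simp_all add: inversion_automorphism_iff K_algebra_automorphism_def ring_iso_def)
  interpret \<alpha>: comm_ring_hom "\<lambda>a :: ('k, 'n) mpoly. abs_gl (to_S\<Delta> a)"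
    by (rule comm_ring_hom_abs_gl[OF to_S\<Delta>_hom])
  interpret \<beta>: comm_ring_hom "\<lambda>a. abs_gl (\<phi> (to_S\<Delta> a))"
    using comm_ring_hom_abs_gl[OF ring_hom_trans[OF to_S\<Delta>_hom \<phi>]] by (simp add: comp_def)
  have "abs_gl (\<phi> (to_S\<Delta> (principal_minor gen_mat I))) = principal_minor ?B (- (- I))"
    using \<beta>.principal_minor[of gen_mat I] by simp
  also have "\<dots> = abs_gl (to_S\<Delta> (principal_minor gen_mat (- I))) * det ?B"
    unfolding principal_minor_inverse[OF AB] using \<alpha>.principal_minor[of gen_mat "- I"] by simp
  finally have "rep_gl (abs_gl (\<phi> (to_S\<Delta> (principal_minor gen_mat I)))) =
      to_S\<Delta> (principal_minor gen_mat (- I)) \<otimes>\<^bsub>S\<Delta>_ring\<^esub> rep_gl (det ?B)"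
    by (simp add: rep_gl_mult)
  then show "\<phi> (to_S\<Delta> (principal_minor gen_mat I)) =
      to_S\<Delta> (principal_minor gen_mat (- I)) \<otimes>\<^bsub>S\<Delta>_ring\<^esub> rep_gl (det ?B)"
    using ring_hom_closed[OF \<phi> to_S\<Delta>_closed] by (simp add: abs_gl_inverse)
  show "rep_gl (det ?B) \<in> carrier S\<Delta>_ring" by (rule rep_gl)
qed

lemma ideal_P_ideal_S\<Delta>: "ideal (P_ideal_S\<Delta> s) S\<Delta>_ring"
  unfolding P_ideal_S\<Delta>_def
  by (intro ring.genideal_ideal cring.axioms(1)[OF cring_S\<Delta>]) auto

text \<open>
  \<open>P\<^sub>s S\<^sub>\<Delta>\<close> is generated in two stages, first in \<open>S\<close> and then in \<open>S\<^sub>\<Delta>\<close>. Preimages of ideals are ideals, so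
  both times it is enough to look at generators.
\<close>

lemma inversion_automorphism_P_ideal_subset:
  assumes inv: "inversion_automorphism (\<phi> :: ('k::comm_ring_1, 'n::finite) S\<Delta> \<Rightarrow> ('k, 'n) S\<Delta>)"
  shows "\<phi> ` P_ideal_S\<Delta> s \<subseteq> P_ideal_S\<Delta> (CARD('n) - s)"
proof -
  let ?J = "P_ideal_S\<Delta> (CARD('n) - s) :: ('k, 'n) S\<Delta> set"
  interpret R: cring "S\<Delta>_ring :: ('k, 'n) S\<Delta> ring" by (rule cring_S\<Delta>)
  interpret J: ideal ?J S\<Delta>_ring by (rule ideal_P_ideal_S\<Delta>)
  have \<phi>: "\<phi> \<in> ring_hom S\<Delta>_ring S\<Delta>_ring"
    using inv by (simp add: inversion_automorphism_def K_algebra_automorphism_def ring_iso_def)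
  interpret \<phi>: ring_hom_ring S\<Delta>_ring S\<Delta>_ring \<phi>
    by (intro ring_hom_ringI2 R.ring_axioms \<phi>)
  interpret \<phi>t: ring_hom_ring S_ring S\<Delta>_ring "\<phi> \<circ> to_S\<Delta>"
    by (intro ring_hom_ringI2 R.ring_axioms S\<Delta>.ring_axioms ring_hom_trans[OF to_S\<Delta>_hom \<phi>])
  have "\<phi> (to_S\<Delta> (principal_minor gen_mat I)) \<in> ?J" if "card I = s" for I
  proof -
    have "card (- I) = CARD('n) - s" using that card_Diff_subset[of I UNIV] by (simp add: Compl_eq_Diff_UNIV)
    then have "principal_minor gen_mat (- I) \<in> (P_ideal (CARD('n) - s) :: ('k, 'n) mpoly set)"
      unfolding P_ideal_def by (intro S\<Delta>.genideal_self[THEN subsetD]) auto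
    then have "to_S\<Delta> (principal_minor gen_mat (- I)) \<in> ?J"
      unfolding P_ideal_S\<Delta>_def by (intro R.genideal_self[THEN subsetD]) auto
    then show ?thesis
      using inversion_automorphism_principal_minor[OF inv, of I] J.I_r_closed by metis
  qed
  then have "P_ideal s \<subseteq> {a \<in> carrier S_ring. (\<phi> \<circ> to_S\<Delta>) a \<in> ?J}"
    unfolding P_ideal_def by (intro S\<Delta>.genideal_minimal \<phi>t.ideal_vimage J.is_ideal) auto
  then have "P_ideal_S\<Delta> s \<subseteq> {x \<in> carrier S\<Delta>_ring. \<phi> x \<in> ?J}"
    unfolding P_ideal_S\<Delta>_def[of s] by (intro R.genideal_minimal \<phi>.ideal_vimage J.is_ideal) auto
  then show ?thesis by blast
qed

lemma inversion_automorphism_P_ideal: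
  assumes inv: "inversion_automorphism (\<phi> :: ('k::comm_ring_1, 'n::finite) S\<Delta> \<Rightarrow> ('k, 'n) S\<Delta>)"
    and s: "s \<le> CARD('n)"
  shows "\<phi> ` P_ideal_S\<Delta> (CARD('n) - s) = P_ideal_S\<Delta> s"
proof
  show "\<phi> ` P_ideal_S\<Delta> (CARD('n) - s) \<subseteq> P_ideal_S\<Delta> s"
    using inversion_automorphism_P_ideal_subset[OF inv, of "CARD('n) - s"] s by simp
  show "P_ideal_S\<Delta> s \<subseteq> \<phi> ` P_ideal_S\<Delta> (CARD('n) - s)"
  proof
    fix x :: "('k, 'n) S\<Delta>" assume x: "x \<in> P_ideal_S\<Delta> s"
    interpret ideal "P_ideal_S\<Delta> s :: ('k, 'n) S\<Delta> set" S\<Delta>_ring by (rule ideal_P_ideal_S\<Delta>)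
    have "\<phi> ` carrier S\<Delta>_ring = carrier S\<Delta>_ring"
      using inv by (simp add: inversion_automorphism_def K_algebra_automorphism_def ring_iso_def bij_betw_def)
    then have "x = \<phi> (inv_into (carrier S\<Delta>_ring) \<phi> x)"
      using x a_subset f_inv_into_f[of x \<phi> "carrier S\<Delta>_ring"] by auto
    moreover have "inv_into (carrier S\<Delta>_ring) \<phi> x \<in> P_ideal_S\<Delta> (CARD('n) - s)"
      using inversion_automorphism_P_ideal_subset[OF inversion_automorphism_inv[OF inv], of s] x by blast
    ultimately show "x \<in> \<phi> ` P_ideal_S\<Delta> (CARD('n) - s)" by blast
  qed
qed

theorem theorem3:
  fixes t :: nat
  assumes "1 \<le> t" and "t \<le> CARD('n::finite) - 1"
  shows "(\<exists>\<phi> :: ('k::alg_closed_field, 'n) S\<Delta> \<Rightarrow> ('k, 'n) S\<Delta>. inversion_automorphism \<phi>) \<and>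
    (\<forall>\<phi> :: ('k, 'n) S\<Delta> \<Rightarrow> ('k, 'n) S\<Delta>. inversion_automorphism \<phi> \<longrightarrow>
      (\<exists>\<psi>. lrs_isomorphism (Y_scheme t) (Y_scheme (CARD('n) - t)) \<psi> \<and>
        rs_eq (Y_scheme t) (Spec S\<Delta>_ring)
          (rs_comp (Y_scheme (CARD('n) - t)) (Y_immersion (CARD('n) - t)) \<psi>)
          (rs_comp (Spec S\<Delta>_ring) (Spec_map S\<Delta>_ring S\<Delta>_ring \<phi>) (Y_immersion t))))"
proof (intro conjI allI impI)
  show "\<exists>\<phi> :: ('k, 'n) S\<Delta> \<Rightarrow> ('k, 'n) S\<Delta>. inversion_automorphism \<phi>"
    by (rule exists_inversion_automorphism)
next
  fix \<phi> :: "('k, 'n) S\<Delta> \<Rightarrow> ('k, 'n) S\<Delta>" assume inv: "inversion_automorphism \<phi>"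
  have iso: "\<phi> \<in> ring_iso S\<Delta>_ring S\<Delta>_ring"
    using inv by (simp add: inversion_automorphism_def K_algebra_automorphism_def)
  have "\<phi> ` P_ideal_S\<Delta> (CARD('n) - t) = P_ideal_S\<Delta> t"
    using inversion_automorphism_P_ideal[OF inv] assms by simp
  then show "\<exists>\<psi>. lrs_isomorphism (Y_scheme t) (Y_scheme (CARD('n) - t)) \<psi> \<and>
      rs_eq (Y_scheme t) (Spec S\<Delta>_ring)
        (rs_comp (Y_scheme (CARD('n) - t)) (Y_immersion (CARD('n) - t)) \<psi>)
        (rs_comp (Spec S\<Delta>_ring) (Spec_map S\<Delta>_ring S\<Delta>_ring \<phi>) (Y_immersion t))"
    by (rule closed_subscheme_iso[OF cring_S\<Delta> cring_S\<Delta> ideal_P_ideal_S\<Delta> ideal_P_ideal_S\<Delta> iso]) blast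
qed

end
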